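(* The surface $$D_d:\quad f=x^{d-1}z+y^d+x^{d-2}yw+x^4y^{d-4}=0$$ in $\mathbb{P}^3$ is nearly free with exponents $(d_1,d_2,d_3)$ equal to (1) $(1,1,2)$ for $d=4$; (2) $(1,1,3)$ for $d=5$; (3) $(1,1,4)$ for $d=6$; (4) $(1,4,4)$ for $d=9$; (5) $(1,4,5)$ for $d=10$; (6) $(1,5,d-6)$ for every $d\geq 11$.
   Context: $S=\mathbb{C}[x,y,z,w]$ is the standard graded coordinate ring of $\mathbb{P}^3$. For $f\in S$ homogeneous of degree $d$, $J_f$ is the ideal generated by the partial derivatives of $f$ and $M(f)=S/J_f$ is the Milnor algebra. A surface is a cone if, after a linear change of coordinates, $f$ does not depend on one of the variables. A reduced surface $D:f=0$ of degree $d$ that is not a cone is called nearly free with exponents $1\le d_1\le d_2\le d_3$ if the minimal graded free resolution of $M(f)$ has the form $$0\to S(-d_3-d)\to S(-d_1-(d-1))\oplus S(-d_2-(d-1))\oplus S(-d_3-(d-1))^2\to S(-(d-1))^4\to S.$$ *)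

theory Defs
  imports
    "HOL-Analysis.Cartesian_Space"
    "HOL-Library.Poly_Mapping"
    "HOL-Computational_Algebra.Squarefree"
    "Jordan_Normal_Form.Matrix_Kernel"
begin

text \<open>
  The ring \<open>S = \<complex>[x,y,z,w]\<close>: finitely supported functions from exponent vectors to \<open>\<complex>\<close>, with
  the convolution product of \<^theory>\<open>HOL-Library.Poly_Mapping\<close>. The variables \<open>x, y, z, w\<close> are
  indexed by the elements \<open>0, 1, 2, 3\<close> of the four-element type \<^typ>\<open>4\<close>.
\<close>

type_synonym S = "(4 \<Rightarrow>\<^sub>0 nat) \<Rightarrow>\<^sub>0 complex"

definition Const :: "complex \<Rightarrow> S" where
  "Const c = Poly_Mapping.single 0 c"

definition Var :: "4 \<Rightarrow> S" where
  "Var i = Poly_Mapping.single (Poly_Mapping.single i 1) 1"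

definition mon_degree :: "(4 \<Rightarrow>\<^sub>0 nat) \<Rightarrow> nat" where
  "mon_degree m = (\<Sum>i\<in>UNIV. Poly_Mapping.lookup m i)"

text \<open>As usual, the zero polynomial is homogeneous of every degree.\<close>

definition homogeneous :: "nat \<Rightarrow> S \<Rightarrow> bool" where
  "homogeneous d p \<longleftrightarrow> (\<forall>m\<in>Poly_Mapping.keys p. mon_degree m = d)"

text \<open>
  In the exponent vector below the subtraction is truncated, but it only truncates when the
  coefficient vanishes.
\<close>

definition partial_deriv :: "4 \<Rightarrow> S \<Rightarrow> S" where
  "partial_deriv i p =
     (\<Sum>m\<in>Poly_Mapping.keys p. Poly_Mapping.single (m - Poly_Mapping.single i 1) (of_nat (Poly_Mapping.lookup m i) * Poly_Mapping.lookup p m))"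

definition jacobian_ideal :: "S \<Rightarrow> S set" where
  "jacobian_ideal f = {\<Sum>i\<in>UNIV. a i * partial_deriv i f | a. True}"

text \<open>The residue class of \<open>p\<close> in \<open>S/I\<close>; the quotient \<open>S/I\<close> itself is the set of all these classes.\<close>

definition residue_class :: "S set \<Rightarrow> S \<Rightarrow> S set" where
  "residue_class I p = {p + q | q. q \<in> I}"

definition quotient_ring :: "S set \<Rightarrow> S set set" where
  "quotient_ring I = range (residue_class I)"


text \<open>
  A list \<open>as = [a\<^sub>0, \<dots>, a\<^sub>n\<^sub>-\<^sub>1]\<close> encodes the graded free module \<open>S(-a\<^sub>0) \<oplus> \<dots> \<oplus> S(-a\<^sub>n\<^sub>-\<^sub>1)\<close>, whose
  elements are the vectors in \<open>carrier_vec n\<close>. A degree-preserving homomorphism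
  from the module of \<open>bs\<close> to that of \<open>as\<close> is a matrix acting on column vectors whose \<open>(i,j)\<close> entry is
  homogeneous of degree \<open>b\<^sub>j - a\<^sub>i\<close>, hence zero if this number is negative.
\<close>

definition graded_hom :: "nat list \<Rightarrow> nat list \<Rightarrow> S mat \<Rightarrow> bool" where
  "graded_hom bs as A \<longleftrightarrow>
     A \<in> carrier_mat (length as) (length bs) \<and>
     (\<forall>i<length as. \<forall>j<length bs.
        if as ! i \<le> bs ! j then homogeneous (bs ! j - as ! i) (A $$ (i, j)) else A $$ (i, j) = 0)"

definition mat_image :: "S mat \<Rightarrow> S vec set" where
  "mat_image A = {A *\<^sub>v u | u. u \<in> carrier_vec (dim_col A)}"

text \<open>The image of \<open>F\<^sub>k\<^sub>+\<^sub>1 \<rightarrow> F\<^sub>k\<close>, where \<open>F\<^sub>k\<^sub>+\<^sub>1 = 0\<close> past the end of the list \<open>ds\<close>.\<close>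

definition incoming_image :: "nat list list \<Rightarrow> S mat list \<Rightarrow> nat \<Rightarrow> S vec set" where
  "incoming_image Fs ds k =
     (if k < length ds then mat_image (ds ! k) else {0\<^sub>v (length (Fs ! k))})"

text \<open>
  With \<open>Fs = [F\<^sub>0, \<dots>, F\<^sub>r]\<close> and \<open>ds = [d\<^sub>1, \<dots>, d\<^sub>r]\<close>, so that \<open>ds ! k\<close> is the map \<open>F\<^sub>k\<^sub>+\<^sub>1 \<rightarrow> F\<^sub>k\<close>:
  the sequence \<open>0 \<rightarrow> F\<^sub>r \<rightarrow> \<dots> \<rightarrow> F\<^sub>0 \<rightarrow> S/I \<rightarrow> 0\<close> is a minimal graded free resolution of the graded
  \<open>S\<close>-module \<open>S/I\<close>. The augmentation \<open>F\<^sub>0 \<rightarrow> S/I\<close> sends the \<open>j\<close>-th basis vector to the class of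
  \<open>e $ j\<close>, and the zero element of \<open>S/I\<close> is \<open>I\<close>. Minimality says that \<open>d\<^sub>k\<^sub>+\<^sub>1\<close> maps \<open>F\<^sub>k\<^sub>+\<^sub>1\<close> into
  \<open>(x,y,z,w) F\<^sub>k\<close>, i.e. all matrix entries have zero constant term.
\<close>

definition minimal_graded_free_resolution ::
  "S set \<Rightarrow> nat list list \<Rightarrow> S vec \<Rightarrow> S mat list \<Rightarrow> bool" where
  "minimal_graded_free_resolution I Fs e ds \<longleftrightarrow>
     length Fs = Suc (length ds) \<and>
     e \<in> carrier_vec (length (Fs ! 0)) \<and>
     (\<forall>j<length (Fs ! 0). homogeneous (Fs ! 0 ! j) (e $ j)) \<and>
     (\<forall>k<length ds. graded_hom (Fs ! Suc k) (Fs ! k) (ds ! k)) \<and>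
     (\<lambda>u. residue_class I (e \<bullet> u)) ` carrier_vec (length (Fs ! 0)) = quotient_ring I \<and>
     {u \<in> carrier_vec (length (Fs ! 0)). residue_class I (e \<bullet> u) = I} = incoming_image Fs ds 0 \<and>
     (\<forall>k<length ds. mat_kernel (ds ! k) = incoming_image Fs ds (Suc k)) \<and>
     (\<forall>k<length ds. \<forall>i<length (Fs ! k). \<forall>j<length (Fs ! Suc k). Poly_Mapping.lookup (ds ! k $$ (i, j)) 0 = 0)"


text \<open>
  The polynomial \<open>f(l\<^sub>0, l\<^sub>1, l\<^sub>2, l\<^sub>3)\<close> with \<open>l\<^sub>i = \<Sum>\<^sub>j A\<^sub>i\<^sub>j X\<^sub>j\<close>. Entries of \<open>A\<close> are written with
  \<open>vec_nth\<close> because \<open>$\<close> also denotes indexing of the vectors with carrier used above.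
\<close>

definition linear_change :: "complex^4^4 \<Rightarrow> S \<Rightarrow> S" where
  "linear_change A f =
     (\<Sum>m\<in>Poly_Mapping.keys f. Const (Poly_Mapping.lookup f m) *
        (\<Prod>i\<in>UNIV. (\<Sum>j\<in>UNIV. Const (vec_nth (vec_nth A i) j) * Var j) ^ Poly_Mapping.lookup m i))"

definition is_cone :: "S \<Rightarrow> bool" where
  "is_cone f \<longleftrightarrow>
     (\<exists>A :: complex^4^4. invertible A \<and> (\<exists>i. \<forall>m\<in>Poly_Mapping.keys (linear_change A f). Poly_Mapping.lookup m i = 0))"

text \<open>
  The surface \<open>f = 0\<close> of degree \<open>d\<close> is nearly free with exponents \<open>(d\<^sub>1, d\<^sub>2, d\<^sub>3)\<close>; the surface being
  reduced means that \<open>f\<close> is squarefree (in particular nonzero).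
\<close>

definition nearly_free :: "nat \<Rightarrow> S \<Rightarrow> nat \<Rightarrow> nat \<Rightarrow> nat \<Rightarrow> bool" where
  "nearly_free d f d1 d2 d3 \<longleftrightarrow>
     1 \<le> d \<and> homogeneous d f \<and> squarefree f \<and> \<not> is_cone f \<and>
     1 \<le> d1 \<and> d1 \<le> d2 \<and> d2 \<le> d3 \<and>
     (\<exists>e ds. minimal_graded_free_resolution (jacobian_ideal f)
        [[0],
         replicate 4 (d - 1),
         [d1 + (d - 1), d2 + (d - 1), d3 + (d - 1), d3 + (d - 1)],
         [d3 + d]] e ds)"

definition surface_poly :: "nat \<Rightarrow> S" where
  "surface_poly d = (let x = Var 0; y = Var 1; z = Var 2; w = Var 3 in
     x ^ (d - 1) * z + y ^ d + x ^ (d - 2) * y * w + x ^ 4 * y ^ (d - 4))"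

end

theory Submission
  imports Defs
begin

text \<open>
  The partial derivatives of \<open>f\<close> with respect to \<open>z\<close> and \<open>w\<close> are \<open>x\<^bsup>d-1\<^esup>\<close> and \<open>x\<^bsup>d-2\<^esup>y\<close>. They have the linear
  syzygy \<open>(0, 0, y, -x)\<close>, which accounts for the exponent \<open>1\<close>, and every other syzygy is determined modulo this one
  by its entries \<open>(a, b)\<close> at \<open>p = \<partial>f/\<partial>x\<close> and \<open>q = \<partial>f/\<partial>y\<close>. The possible pairs turn out to be
  generated by three explicit ones, of degrees \<open>d\<^sub>2, d\<^sub>3, d\<^sub>3\<close>. The \<open>2 \<times> 2\<close> minors of the \<open>2 \<times> 3\<close> matrix of these
  pairs are \<open>x\<^bsup>d-2\<^esup>\<close> times, up to units, \<open>y\<^bsup>j\<^esup>\<close>, \<open>w + \<lambda>y\<close> and \<open>x\<close>, and these cofactors are the one relation between the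
  generators. This is the shape of the resolution of a nearly free surface.

  Exactness follows the pattern of the Buchsbaum-Eisenbud criterion, made elementary. By Cramer's rule every syzygy is
  in the span of the generators after multiplication by \<open>x\<^bsup>d-1\<^esup>\<close> (\<open>x_power_spanned\<close>), and also after multiplication
  by an element that is a power of \<open>y\<close> modulo \<open>x\<close> (\<open>r1_q_spanned\<close>). The difference of two such representations is a
  multiple of the relation, and since the entry \<open>w + \<lambda>y\<close> of the relation is regular modulo \<open>x\<close> and powers of \<open>y\<close>, a
  factor \<open>x\<close> can be cancelled (\<open>spanned_cancel_x\<close>). What remains for each degree is to exhibit the generators and to check
  polynomial identities; for \<open>d \<ge> 11\<close> these are identities in \<open>x\<^bsup>d-11\<^esup>\<close>, \<open>y\<^bsup>d-11\<^esup>\<close> and \<open>d\<close>.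

  That \<open>f\<close> is reduced and not a cone also comes from the simple form of the derivatives in \<open>z\<close> and \<open>w\<close>:
  \<open>x\<close> is prime and does not divide \<open>f\<close>, and a translation that leaves \<open>f\<close> invariant is trivial.
\<close>

section \<open>Constants and sums over the four variables\<close>

lemma UNIV_four: "(UNIV :: 4 set) = {0, 1, 2, 3}"
proof -
  have "(4 :: 4) = 0" by simp
  then show ?thesis unfolding UNIV_4 by (simp only: insert_commute)
qed

lemma prod_four: "(\<Prod>i\<in>UNIV. g (i::4)) = g 0 * g 1 * g 2 * (g 3 :: 'a::comm_monoid_mult)"
  unfolding UNIV_four by (simp add: mult.assoc)

lemma sum_four: "(\<Sum>i\<in>UNIV. g (i::4)) = g 0 + g 1 + g 2 + (g 3 :: 'a::comm_monoid_add)"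
  unfolding UNIV_four by (simp add: add.assoc)

lemma Const_0 [simp]: "Const 0 = 0"
  by (simp add: Const_def)

lemma Const_1 [simp]: "Const 1 = 1"
  by (simp add: Const_def)

lemma Const_add: "Const (a + b) = Const a + Const b"
  by (simp add: Const_def single_add)

lemma Const_mult: "Const (a * b) = Const a * Const b"
  by (simp add: Const_def mult_single)

lemma Const_power: "Const (a ^ n) = Const a ^ n"
  by (induction n) (simp_all add: Const_mult)

lemma Const_of_nat: "Const (of_nat n) = of_nat n"
  by (simp add: Const_def)

lemma Const_numeral: "Const (numeral n) = numeral n"
  by (simp add: Const_def)

lemma Const_eq_iff [simp]: "Const a = Const b \<longleftrightarrow> a = b"
  by (simp add: Const_def inj_eq)

lemma Const_dvd_one: "c \<noteq> 0 \<Longrightarrow> Const c dvd 1"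
  by (rule dvdI[of _ _ "Const (inverse c)"]) (simp flip: Const_mult)

section \<open>Substitution into polynomials\<close>

lemma sum_of_terms: "p = (\<Sum>m\<in>Poly_Mapping.keys p. Poly_Mapping.single m (Poly_Mapping.lookup p m))"
  by (rule poly_mapping_eqI)
     (auto simp: lookup_sum lookup_single when_def in_keys_iff)

lemma poly_term_induct [case_names monomial add]:
  assumes "\<And>m c. P (Poly_Mapping.single m c)" "\<And>p q. P p \<Longrightarrow> P q \<Longrightarrow> P (p + q)"
  shows "P (p :: S)"
proof -
  have "P (\<Sum>m\<in>A. Poly_Mapping.single m (Poly_Mapping.lookup p m))" if "finite A" for A
    using that
  proof induction
    case empty
    show ?case using assms(1)[of 0 0] by simp
  next
    case (insert m A)
    then show ?case using assms by simp
  qed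
  then show ?thesis by (subst sum_of_terms) simp
qed

text \<open>
  Substituting the polynomials \<open>\<sigma> i\<close> for the variables covers three needs at once: setting variables
  to zero, evaluating at a point (constant \<open>\<sigma> i\<close>), and the linear change of coordinates in the
  definition of a cone.
\<close>
definition subst_poly :: "(4 \<Rightarrow> S) \<Rightarrow> S \<Rightarrow> S" where
  "subst_poly \<sigma> p = (\<Sum>m\<in>Poly_Mapping.keys p. Const (Poly_Mapping.lookup p m) *
     (\<Prod>i\<in>UNIV. \<sigma> i ^ Poly_Mapping.lookup m i))"

lemma subst_poly_superset:
  "finite K \<Longrightarrow> Poly_Mapping.keys p \<subseteq> K \<Longrightarrow>
   subst_poly \<sigma> p = (\<Sum>m\<in>K. Const (Poly_Mapping.lookup p m) * (\<Prod>i\<in>UNIV. \<sigma> i ^ Poly_Mapping.lookup m i))"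
  unfolding subst_poly_def by (rule sum.mono_neutral_left) (auto simp: in_keys_iff)

lemma subst_poly_add: "subst_poly \<sigma> (p + q) = subst_poly \<sigma> p + subst_poly \<sigma> q"
proof -
  let ?K = "Poly_Mapping.keys p \<union> Poly_Mapping.keys q"
  have "Poly_Mapping.keys (p + q) \<subseteq> ?K" by (rule keys_add)
  then show ?thesis
    by (simp add: subst_poly_superset[of ?K] lookup_add Const_add distrib_right sum.distrib)
qed

lemma subst_poly_0 [simp]: "subst_poly \<sigma> 0 = 0"
  by (simp add: subst_poly_def)

lemma subst_poly_single:
  "subst_poly \<sigma> (Poly_Mapping.single m c) = Const c * (\<Prod>i\<in>UNIV. \<sigma> i ^ Poly_Mapping.lookup m i)"
  by (cases "c = 0") (simp_all add: subst_poly_def)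

lemma subst_poly_mult: "subst_poly \<sigma> (p * q) = subst_poly \<sigma> p * subst_poly \<sigma> q"
proof (induction p rule: poly_term_induct)
  case (monomial m c)
  show ?case
    by (induction q rule: poly_term_induct)
       (simp_all add: mult_single subst_poly_single Const_mult lookup_add power_add prod.distrib
         subst_poly_add distrib_left distrib_right mult_ac)
next
  case (add p q)
  then show ?case by (simp add: subst_poly_add distrib_right)
qed

lemma subst_poly_Const [simp]: "subst_poly \<sigma> (Const c) = Const c"
  by (simp add: Const_def subst_poly_single)

lemma subst_poly_1 [simp]: "subst_poly \<sigma> 1 = 1"
  using subst_poly_Const[of \<sigma> 1] by simp

lemma subst_poly_Var [simp]: "subst_poly \<sigma> (Var i) = \<sigma> i"
proof -
  have "(\<Prod>j\<in>UNIV. \<sigma> j ^ Poly_Mapping.lookup (Poly_Mapping.single i 1) j) = (\<Prod>j\<in>UNIV. if j = i then \<sigma> j else 1)"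
    by (rule prod.cong) (auto simp: lookup_single)
  then show ?thesis by (simp add: Var_def subst_poly_single)
qed

lemma subst_poly_power: "subst_poly \<sigma> (p ^ n) = subst_poly \<sigma> p ^ n"
  by (induction n) (simp_all add: subst_poly_mult)

lemma subst_poly_sum: "subst_poly \<sigma> (sum g A) = (\<Sum>i\<in>A. subst_poly \<sigma> (g i))"
  by (induction A rule: infinite_finite_induct) (simp_all add: subst_poly_add)

lemma subst_poly_prod: "subst_poly \<sigma> (prod g A) = (\<Prod>i\<in>A. subst_poly \<sigma> (g i))"
  by (induction A rule: infinite_finite_induct) (simp_all add: subst_poly_mult)

lemma subst_poly_numeral [simp]: "subst_poly \<sigma> (numeral k) = numeral k"
  using subst_poly_Const[of \<sigma> "numeral k"] by (simp add: Const_numeral)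

lemma subst_poly_of_nat [simp]: "subst_poly \<sigma> (of_nat k) = of_nat k"
  using subst_poly_Const[of \<sigma> "of_nat k"] by (simp add: Const_of_nat)

lemma subst_poly_uminus: "subst_poly \<sigma> (- p) = - subst_poly \<sigma> p"
  using subst_poly_add[of \<sigma> p "- p"] by (simp add: eq_neg_iff_add_eq_0 add.commute)

lemma subst_poly_diff: "subst_poly \<sigma> (p - q) = subst_poly \<sigma> p - subst_poly \<sigma> q"
  using subst_poly_add[of \<sigma> p "- q"] by (simp add: subst_poly_uminus)

lemmas subst_poly_hom = subst_poly_add subst_poly_mult subst_poly_power subst_poly_uminus subst_poly_diff

lemma subst_poly_subst_poly:
  "subst_poly \<tau> (subst_poly \<sigma> p) = subst_poly (\<lambda>i. subst_poly \<tau> (\<sigma> i)) p"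
  by (simp add: subst_poly_def[of \<sigma>] subst_poly_def[of "\<lambda>i. subst_poly \<tau> (\<sigma> i)"]
      subst_poly_sum subst_poly_mult subst_poly_prod subst_poly_power)

lemma Var_power: "Var i ^ n = Poly_Mapping.single (Poly_Mapping.single i n) 1"
  by (induction n) (simp_all add: Var_def mult_single flip: single_add)

lemma monomial_eq: "Poly_Mapping.single m c = Const c * (\<Prod>i\<in>UNIV. Var i ^ Poly_Mapping.lookup m i)"
proof -
  have "(\<Prod>i\<in>A. Var i ^ k i) = Poly_Mapping.single (\<Sum>i\<in>A. Poly_Mapping.single i (k i)) 1" for A k
    by (induction A rule: infinite_finite_induct) (simp_all add: Var_power mult_single)
  moreover have "(\<Sum>i\<in>UNIV. Poly_Mapping.single i (Poly_Mapping.lookup m i)) = m"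
    by (rule poly_mapping_eqI) (simp add: lookup_sum lookup_single when_def)
  ultimately show ?thesis by (simp add: Const_def mult_single)
qed

lemma poly_induct [case_names Const Var add mult]:
  assumes "\<And>c. P (Const c)" "\<And>i. P (Var i)"
    "\<And>p q. P p \<Longrightarrow> P q \<Longrightarrow> P (p + q)" "\<And>p q. P p \<Longrightarrow> P q \<Longrightarrow> P (p * q)"
  shows "P p"
proof (induction p rule: poly_term_induct)
  case (monomial m c)
  have pow: "P (Var i ^ n)" for i n
    by (induction n) (use assms assms(1)[of 1] in simp_all)
  then show ?case
    by (simp add: monomial_eq prod_four assms)
next
  case (add p q)
  then show ?case by (rule assms)
qed

lemma Var_nonzero [simp]: "Var i \<noteq> 0"
  by (simp add: Var_def) (metis lookup_single_eq lookup_zero zero_neq_one)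

section \<open>Divisibility by variables\<close>

text \<open>
  Both sides are compatible with sums and products, so it suffices to look at constants and
  variables. This is the division of \<open>p\<close> by the variable \<open>Var i\<close> with remainder.
\<close>
lemma mod_Var: "\<exists>\<alpha>. p = subst_poly (Var(i := 0)) p + Var i * \<alpha>"
proof (induction p rule: poly_induct)
  case (Const c)
  show ?case by (rule exI[of _ 0]) simp
next
  case (Var j)
  show ?case by (cases "j = i") (auto intro: exI[of _ 0] exI[of _ 1])
next
  case (add p q)
  then obtain \<alpha> \<beta> where "p = subst_poly (Var(i := 0)) p + Var i * \<alpha>"
    "q = subst_poly (Var(i := 0)) q + Var i * \<beta>"
    by blast
  then have "p + q = subst_poly (Var(i := 0)) (p + q) + Var i * (\<alpha> + \<beta>)"
    by (metis (no_types) subst_poly_add distrib_left add.assoc add.left_commute)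
  then show ?case by blast
next
  case (mult p q)
  obtain P Q where PQ: "P = subst_poly (Var(i := 0)) p" "Q = subst_poly (Var(i := 0)) q" by blast
  with mult obtain \<alpha> \<beta> where "p = P + Var i * \<alpha>" "q = Q + Var i * \<beta>"
    by metis
  then have "p * q = P * Q + Var i * (P * \<beta> + \<alpha> * Q + Var i * \<alpha> * \<beta>)"
    by (simp add: algebra_simps)
  then show ?case unfolding subst_poly_mult PQ by blast
qed

text \<open>
  Divisibility by a variable is the vanishing of a ring homomorphism into a domain, which makes
  variables prime.
\<close>
lemma Var_dvd_iff: "Var i dvd p \<longleftrightarrow> subst_poly (Var(i := 0)) p = 0"
proof
  assume "subst_poly (Var(i := 0)) p = 0"
  with mod_Var[of p i] show "Var i dvd p" by auto
qed (auto simp: subst_poly_mult)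

lemma prime_elem_Var: "prime_elem (Var i)"
  by (rule prime_elemI) (auto simp: Var_dvd_iff subst_poly_mult)

lemma Var_dvd_Var_iff: "Var i dvd Var j \<longleftrightarrow> i = j"
  by (auto simp: Var_dvd_iff)

text \<open>
  The ideal of two variables is also the kernel of a homomorphism into a domain, by dividing
  successively by the two variables.
\<close>
lemma in_ideal_two_Vars_iff:
  assumes "i \<noteq> j"
  shows "(\<exists>\<alpha> \<beta>. p = Var i * \<alpha> + Var j * \<beta>) \<longleftrightarrow> subst_poly (Var(i := 0, j := 0)) p = 0"
proof
  assume "\<exists>\<alpha> \<beta>. p = Var i * \<alpha> + Var j * \<beta>"
  then show "subst_poly (Var(i := 0, j := 0)) p = 0" by (auto simp: subst_poly_hom)
next
  assume *: "subst_poly (Var(i := 0, j := 0)) p = 0"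
  have "(\<lambda>k. subst_poly (Var(j := 0)) ((Var(i := 0)) k)) = Var(i := 0, j := 0)"
    using assms by auto
  then have "subst_poly (Var(j := 0)) (subst_poly (Var(i := 0)) p) = 0"
    using * by (simp add: subst_poly_subst_poly)
  then have "Var j dvd subst_poly (Var(i := 0)) p" by (simp add: Var_dvd_iff)
  then obtain \<beta> where "subst_poly (Var(i := 0)) p = Var j * \<beta>" by blast
  with mod_Var[of p i] show "\<exists>\<alpha> \<beta>. p = Var i * \<alpha> + Var j * \<beta>"
    by (metis add.commute)
qed

section \<open>Partial derivatives\<close>

lemma partial_deriv_superset:
  "finite K \<Longrightarrow> Poly_Mapping.keys p \<subseteq> K \<Longrightarrow>
   partial_deriv i p = (\<Sum>m\<in>K. Poly_Mapping.single (m - Poly_Mapping.single i 1)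
     (of_nat (Poly_Mapping.lookup m i) * Poly_Mapping.lookup p m))"
  unfolding partial_deriv_def by (rule sum.mono_neutral_left) (auto simp: in_keys_iff)

lemma partial_deriv_add: "partial_deriv i (p + q) = partial_deriv i p + partial_deriv i q"
proof -
  let ?K = "Poly_Mapping.keys p \<union> Poly_Mapping.keys q"
  have "Poly_Mapping.keys (p + q) \<subseteq> ?K" by (rule keys_add)
  then show ?thesis
    by (simp add: partial_deriv_superset[of ?K] lookup_add distrib_left single_add sum.distrib)
qed

lemma partial_deriv_single:
  "partial_deriv i (Poly_Mapping.single m c) =
   Poly_Mapping.single (m - Poly_Mapping.single i 1) (of_nat (Poly_Mapping.lookup m i) * c)"
  by (cases "c = 0") (simp_all add: partial_deriv_def)

text \<open>
  The truncated subtraction of exponent vectors behaves well exactly when the variable occurs; in the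
  product rule the other case comes with coefficient zero.
\<close>
lemma single_minus_add:
  assumes "Poly_Mapping.lookup m i \<noteq> 0"
  shows "(m - Poly_Mapping.single i (1::nat)) + n = m + n - Poly_Mapping.single i 1"
  using assms by (intro poly_mapping_eqI) (auto simp: lookup_add lookup_minus lookup_single when_def)

lemma partial_deriv_mult_single:
  "partial_deriv i (Poly_Mapping.single m c * Poly_Mapping.single n d) =
   partial_deriv i (Poly_Mapping.single m c) * Poly_Mapping.single n d +
   Poly_Mapping.single m c * partial_deriv i (Poly_Mapping.single n d)"
proof -
  let ?e = "Poly_Mapping.single i (1::nat)"
  have "Poly_Mapping.single ((m - ?e) + n) (of_nat (Poly_Mapping.lookup m i) * c * d) =
      Poly_Mapping.single (m + n - ?e) (of_nat (Poly_Mapping.lookup m i) * c * d)"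
    using single_minus_add[of m i n] by (cases "Poly_Mapping.lookup m i = 0") simp_all
  moreover have "Poly_Mapping.single (m + (n - ?e)) (c * (of_nat (Poly_Mapping.lookup n i) * d)) =
      Poly_Mapping.single (m + n - ?e) (c * (of_nat (Poly_Mapping.lookup n i) * d))"
    using single_minus_add[of n i m]
    by (cases "Poly_Mapping.lookup n i = 0") (simp_all add: add.commute)
  ultimately show ?thesis
    by (simp add: partial_deriv_single mult_single lookup_add algebra_simps flip: single_add)
qed

lemma partial_deriv_mult: "partial_deriv i (p * q) = partial_deriv i p * q + p * partial_deriv i q"
proof (induction p rule: poly_term_induct)
  case (monomial m c)
  show ?case
  proof (induction q rule: poly_term_induct)
    case (monomial n d)
    show ?case by (rule partial_deriv_mult_single)
  next
    case (add p q)
    then show ?case by (simp add: partial_deriv_add algebra_simps)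
  qed
next
  case (add p q)
  then show ?case by (simp add: partial_deriv_add algebra_simps)
qed

lemma partial_deriv_Var: "partial_deriv i (Var j) = (if i = j then 1 else 0)"
  by (simp add: Var_def partial_deriv_single lookup_single when_def)

lemma partial_deriv_1 [simp]: "partial_deriv i 1 = 0"
  using partial_deriv_single[of i 0 1] by simp

lemma partial_deriv_power: "partial_deriv i (p ^ n) = of_nat n * p ^ (n - 1) * partial_deriv i p"
proof (induction n)
  case (Suc n)
  then show ?case by (cases n) (simp_all add: partial_deriv_mult algebra_simps)
qed simp

section \<open>Homogeneous polynomials\<close>

lemma mon_degree_add: "mon_degree (m + n) = mon_degree m + mon_degree n"
  by (simp add: mon_degree_def lookup_add sum.distrib)

lemma mon_degree_single: "mon_degree (Poly_Mapping.single i n) = n"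
  by (simp add: mon_degree_def lookup_single when_def)

lemma homogeneous_0: "homogeneous d 0"
  by (simp add: homogeneous_def)

lemma homogeneous_Const: "homogeneous 0 (Const c)"
  by (simp add: homogeneous_def Const_def mon_degree_def)

lemma homogeneous_1: "homogeneous 0 1"
  using homogeneous_Const[of 1] by simp

lemma homogeneous_numeral: "homogeneous 0 (numeral k)"
  using homogeneous_Const[of "numeral k"] by (simp add: Const_numeral)

lemma homogeneous_of_nat: "homogeneous 0 (of_nat k)"
  using homogeneous_Const[of "of_nat k"] by (simp add: Const_of_nat)

lemma homogeneous_Var: "homogeneous 1 (Var i)"
  by (simp add: homogeneous_def Var_def mon_degree_single)

lemma homogeneous_add: "homogeneous d p \<Longrightarrow> homogeneous d q \<Longrightarrow> homogeneous d (p + q)"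
  using keys_add[of p q] by (auto simp: homogeneous_def)

lemma homogeneous_uminus: "homogeneous d p \<Longrightarrow> homogeneous d (- p)"
  by (simp add: homogeneous_def in_keys_iff)

lemma homogeneous_diff: "homogeneous d p \<Longrightarrow> homogeneous d q \<Longrightarrow> homogeneous d (p - q)"
  using homogeneous_add[of d p "- q"] by (simp add: homogeneous_uminus)

lemma homogeneous_mult:
  "homogeneous i p \<Longrightarrow> homogeneous j q \<Longrightarrow> d = i + j \<Longrightarrow> homogeneous d (p * q)"
  using keys_mult[of p q] by (auto simp: homogeneous_def mon_degree_add dest!: subsetD)

lemma homogeneous_power: "homogeneous i p \<Longrightarrow> d = i * n \<Longrightarrow> homogeneous d (p ^ n)"
proof (induction n arbitrary: d)
  case (Suc n)
  then show ?case by (auto intro!: homogeneous_mult)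
qed (simp add: homogeneous_1)

lemma homogeneous_Var_mult_cancel:
  assumes "homogeneous (Suc d) (Var i * p)"
  shows "homogeneous d p"
  unfolding homogeneous_def
proof
  fix m assume m: "m \<in> Poly_Mapping.keys p"
  have "Poly_Mapping.lookup (Var i * p) (Poly_Mapping.single i 1 + m) = Poly_Mapping.lookup p m"
    by (induction p rule: poly_term_induct)
       (simp_all add: Var_def mult_single lookup_single when_def distrib_left lookup_add)
  with m have "Poly_Mapping.single i 1 + m \<in> Poly_Mapping.keys (Var i * p)"
    by (simp add: in_keys_iff)
  with assms have "mon_degree (Poly_Mapping.single i 1 + m) = Suc d"
    by (auto simp: homogeneous_def)
  then show "mon_degree m = d" by (simp add: mon_degree_add mon_degree_single)
qed

lemma homogeneous_constant_term: "homogeneous d p \<Longrightarrow> d \<noteq> 0 \<Longrightarrow> Poly_Mapping.lookup p 0 = 0"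
proof (rule ccontr)
  assume "homogeneous d p" "d \<noteq> 0" and "Poly_Mapping.lookup p 0 \<noteq> 0"
  moreover from this have "0 \<in> Poly_Mapping.keys p" by (simp add: in_keys_iff)
  ultimately show False by (auto simp: homogeneous_def mon_degree_def)
qed

section \<open>Cones\<close>

text \<open>
  If \<open>f \<circ> A\<close> does not involve the variable \<open>i\<close>, then \<open>f\<close> is invariant under translation by the \<open>i\<close>-th
  column of \<open>A\<close>, which is nonzero. Working with values of \<open>f\<close> avoids the chain rule.
\<close>
lemma is_coneD:
  assumes "is_cone f"
  obtains c where "c \<noteq> (0 :: complex^4)"
    "\<And>u. subst_poly (\<lambda>i. Const (vec_nth (u + c) i)) f = subst_poly (\<lambda>i. Const (vec_nth u i)) f"
proof -
  obtain A :: "complex^4^4" and i where A: "invertible A"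
    and i: "\<And>m. m \<in> Poly_Mapping.keys (linear_change A f) \<Longrightarrow> Poly_Mapping.lookup m i = 0"
    using assms unfolding is_cone_def by blast
  define pt :: "complex^4 \<Rightarrow> 4 \<Rightarrow> S" where "pt v = (\<lambda>j. Const (vec_nth v j))" for v
  have lc: "linear_change A f = subst_poly (\<lambda>k. \<Sum>j\<in>UNIV. Const (vec_nth (vec_nth A k) j) * Var j) f"
    by (simp add: linear_change_def subst_poly_def)
  have eval: "subst_poly (pt v) (linear_change A f) = subst_poly (pt (A *v v)) f" for v
    unfolding lc subst_poly_subst_poly
  proof (rule arg_cong[of _ _ "\<lambda>\<sigma>. subst_poly \<sigma> f"], rule ext)
    fix k
    have Const_sum: "Const (sum g B) = (\<Sum>j\<in>B. Const (g j))" for g and B :: "4 set"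
      by (induction B rule: infinite_finite_induct) (simp_all add: Const_add)
    show "subst_poly (pt v) (\<Sum>j\<in>UNIV. Const (vec_nth (vec_nth A k) j) * Var j) = pt (A *v v) k"
      by (simp add: pt_def subst_poly_sum subst_poly_mult matrix_vector_mult_def Const_sum Const_mult)
  qed
  define c where "c = A *v axis i 1"
  have "A *v v = 0 \<Longrightarrow> v = 0" for v
    using A by (metis invertible_def matrix_vector_mul_assoc matrix_vector_mul_lid matrix_vector_mult_0_right)
  then have "c \<noteq> 0" unfolding c_def by (metis axis_eq_0_iff zero_neq_one)
  moreover have "subst_poly (pt (u + c)) f = subst_poly (pt u) f" for u
  proof -
    obtain v where v: "u = A *v v"
      using A by (metis invertible_def matrix_vector_mul_assoc matrix_vector_mul_lid)
    have "subst_poly (pt (v + axis i 1)) (linear_change A f) = subst_poly (pt v) (linear_change A f)"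
      unfolding subst_poly_def
    proof (intro sum.cong refl arg_cong2[of _ _ _ _ "(*)"] prod.cong)
      fix m j assume "m \<in> Poly_Mapping.keys (linear_change A f)"
      then show "pt (v + axis i 1) j ^ Poly_Mapping.lookup m j = pt v j ^ Poly_Mapping.lookup m j"
        using i[of m] by (cases "j = i") (simp_all add: pt_def axis_def)
    qed
    then show ?thesis
      by (simp add: eval v c_def matrix_vector_right_distrib)
  qed
  ultimately show ?thesis unfolding pt_def by (rule that)
qed

section \<open>The surfaces are reduced and not cones\<close>

abbreviation "xv \<equiv> Var 0"
abbreviation "yv \<equiv> Var 1"
abbreviation "zv \<equiv> Var 2"
abbreviation "wv \<equiv> Var 3"

lemma surface_poly_eq:
  "surface_poly d = xv ^ (d - 1) * zv + yv ^ d + xv ^ (d - 2) * yv * wv + xv ^ 4 * yv ^ (d - 4)"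
  by (simp add: surface_poly_def Let_def)

lemmas homogeneous_intros = homogeneous_add homogeneous_diff homogeneous_uminus homogeneous_mult
  homogeneous_power homogeneous_Var homogeneous_numeral homogeneous_of_nat homogeneous_1 homogeneous_0

lemma homogeneous_surface_poly: "4 \<le> d \<Longrightarrow> homogeneous d (surface_poly d)"
  unfolding surface_poly_eq by (rule homogeneous_intros | rule refl | simp)+

lemma partial_deriv_surface_poly:
  assumes "4 \<le> d"
  shows "partial_deriv 0 (surface_poly d) = of_nat (d - 1) * xv ^ (d - 2) * zv
      + of_nat (d - 2) * xv ^ (d - 3) * yv * wv + 4 * xv ^ 3 * yv ^ (d - 4)"
    and "partial_deriv 1 (surface_poly d) = of_nat d * yv ^ (d - 1) + xv ^ (d - 2) * wv
      + of_nat (d - 4) * xv ^ 4 * yv ^ (d - 5)"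
    and "partial_deriv 2 (surface_poly d) = xv ^ (d - 1)"
    and "partial_deriv 3 (surface_poly d) = xv ^ (d - 2) * yv"
  using assms
  by (simp_all add: surface_poly_eq partial_deriv_add partial_deriv_mult partial_deriv_power
      partial_deriv_Var eval_nat_numeral algebra_simps)

lemma dvd_prime_power_cases:
  fixes g x :: "'a::idom"
  assumes "prime_elem x" "g dvd x ^ n" "\<not> x dvd g"
  shows "g dvd 1"
  using assms(2)
proof (induction n)
  case (Suc n)
  then obtain h where h: "x * x ^ n = g * h" by (auto elim: dvdE)
  then have "x dvd g * h" by (metis dvd_triv_left)
  then have "x dvd h" using assms by (simp add: prime_elem_dvd_mult_iff)
  then obtain h' where "h = x * h'" by blast
  with h have "x * x ^ n = x * (g * h')" by (simp add: mult.left_commute)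
  then have "x ^ n = g * h'" using assms(1) by (auto simp: prime_elem_def)
  then show ?case by (intro Suc.IH) simp
qed simp

text \<open>
  A square factor \<open>g\<^sup>2\<close> of \<open>f\<close> forces \<open>g\<close> to divide \<open>\<partial>f/\<partial>z = x\<^bsup>d-1\<^esup>\<close>. Since \<open>x\<close> is prime and does not divide \<open>f\<close>
  (modulo \<open>x\<close> only \<open>y\<^bsup>d\<^esup>\<close> survives), \<open>g\<close> is a unit.
\<close>
lemma squarefree_surface_poly:
  assumes "4 \<le> d"
  shows "squarefree (surface_poly d)"
proof (rule squarefreeI)
  fix g assume g: "g ^ 2 dvd surface_poly d"
  then obtain h where h: "surface_poly d = g * g * h" by (auto simp: power2_eq_square)
  have "partial_deriv 2 (surface_poly d) = g * (2 * partial_deriv 2 g * h + g * partial_deriv 2 h)"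
    unfolding h partial_deriv_mult by (simp add: algebra_simps)
  then have "g dvd xv ^ (d - 1)" using partial_deriv_surface_poly(3)[OF assms] by auto
  moreover have "\<not> xv dvd g"
  proof
    assume "xv dvd g"
    then have "xv dvd surface_poly d" unfolding h by simp
    then have "yv ^ d = 0"
      using assms by (simp add: Var_dvd_iff surface_poly_eq subst_poly_hom power_0_left)
    then show False by simp
  qed
  ultimately show "g dvd 1" using prime_elem_Var by (blast intro: dvd_prime_power_cases)
qed

text \<open>
  A translation vector \<open>c\<close> that leaves \<open>f\<close> invariant vanishes: \<open>f\<close> is linear in \<open>z\<close> and \<open>w\<close>, and comparing
  the coefficients \<open>x\<^bsup>d-1\<^esup>\<close> of \<open>z\<close> and \<open>x\<^bsup>d-2\<^esup>y\<close> of \<open>w\<close> before and after the translation kills \<open>c\<^sub>0\<close> and \<open>c\<^sub>1\<close>,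
  after which \<open>c\<^sub>2\<close> and \<open>c\<^sub>3\<close> appear as increments of \<open>f\<close>. A few explicit points suffice.
\<close>
lemma not_cone_surface_poly:
  assumes d: "4 \<le> d"
  shows "\<not> is_cone (surface_poly d)"
proof
  assume "is_cone (surface_poly d)"
  then obtain c where c: "c \<noteq> (0 :: complex^4)"
    "\<And>u. subst_poly (\<lambda>i. Const (vec_nth (u + c) i)) (surface_poly d) =
          subst_poly (\<lambda>i. Const (vec_nth u i)) (surface_poly d)"
    by (rule is_coneD) blast
  define F :: "complex \<Rightarrow> complex \<Rightarrow> complex \<Rightarrow> complex \<Rightarrow> complex" where
    "F x y z w = x ^ (d - 1) * z + y ^ d + x ^ (d - 2) * y * w + x ^ 4 * y ^ (d - 4)" for x y z w
  have eval: "subst_poly (\<lambda>i. Const (vec_nth v i)) (surface_poly d) =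
      Const (F (vec_nth v 0) (vec_nth v 1) (vec_nth v 2) (vec_nth v 3))" for v
    by (simp add: surface_poly_eq subst_poly_hom F_def Const_add Const_mult Const_power)
  have inv': "F (vec_nth (u + c) 0) (vec_nth (u + c) 1) (vec_nth (u + c) 2) (vec_nth (u + c) 3) =
      F (vec_nth u 0) (vec_nth u 1) (vec_nth u 2) (vec_nth u 3)" for u
    using c(2)[of u] unfolding eval by simp
  define c0 c1 c2 c3 where cs: "c0 = vec_nth c 0" "c1 = vec_nth c 1" "c2 = vec_nth c 2" "c3 = vec_nth c 3"
  have inv: "F (x + c0) (y + c1) (z + c2) (w + c3) = F x y z w" for x y z w
    using inv'[of "\<chi> i. if i = 0 then x else if i = 1 then y else if i = 2 then z else w"]
    by (simp add: cs)
  have "c0 ^ (d - 1) = F (0 + c0) (0 + c1) (1 + c2) (0 + c3) - F (0 + c0) (0 + c1) (0 + c2) (0 + c3)"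
    by (simp add: F_def algebra_simps)
  also have "\<dots> = 0"
    unfolding inv using d by (simp add: F_def power_0_left)
  finally have "c0 ^ (d - 1) = 0" .
  then have 0: "c0 = 0" by simp
  have 1: "c1 = 0"
    using inv[of 1 0 0 1] inv[of 1 0 0 0] d by (simp add: F_def 0 algebra_simps)
  have 2: "c2 = 0"
    using inv[of 1 0 0 0] d by (simp add: F_def 0 1)
  have 3: "c3 = 0"
    using inv[of 1 1 0 0] d by (simp add: F_def 0 1 2)
  have "vec_nth c i = 0" for i :: 4
  proof -
    have "i \<in> {0, 1, 2, 3}" using UNIV_four by blast
    then show ?thesis using 0 1 2 3 unfolding cs by fast
  qed
  then have "c = 0" by (simp add: Finite_Cartesian_Product.vec_eq_iff)
  with c(1) show False by simp
qed

section \<open>Syzygies of a row with two monomial entries\<close>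

text \<open>
  The row \<open>(p, q, x\<^bsup>n+1\<^esup>, x\<^bsup>n\<^esup>y)\<close> has the obvious syzygy \<open>(0, 0, y, -x)\<close>. Given three more syzygies
  \<open>(a\<^sub>i, b\<^sub>i, c\<^sub>i, e\<^sub>i)\<close>, the locale collects what makes the four of them generate all syzygies with a single
  relation \<open>(r\<^sub>0, r\<^sub>1, r\<^sub>2, r\<^sub>3)\<close> between them: the \<open>2 \<times> 2\<close> minors of the block of the \<open>a\<^sub>i, b\<^sub>i\<close> are
  \<open>x\<^bsup>n\<^esup>r\<^sub>i\<close>, where \<open>r\<^sub>3\<close> is \<open>x\<close> up to a unit, \<open>r\<^sub>1q\<close> is a power of \<open>y\<close> modulo \<open>x\<close> up to a unit, and \<open>r\<^sub>2\<close> is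
  regular modulo \<open>x\<close> and modulo \<open>(x, y)\<close>. So \<open>r\<^sub>3, r\<^sub>1q, r\<^sub>2\<close> behave like a regular sequence of length three,
  which is the depth that the Buchsbaum-Eisenbud criterion asks for.

  The parameter \<open>xn\<close> stands for \<open>x\<^bsup>n\<^esup>\<close>; as an element of its own it keeps the symbolic exponent out of the
  polynomial identities.
\<close>
locale syzygy_block =
  fixes x y p q xn :: "'a::idom" and n N :: nat
    and a1 a2 a3 b1 b2 b3 c1 c2 c3 e1 e2 e3 r1 r2 r3 k l h :: 'a
  assumes xn_eq: "xn = x ^ n"
    and prime_x: "prime_elem x"
    and x_ndvd_y: "\<not> x dvd y"
    and syz1: "a1 * p + b1 * q + c1 * (x * xn) + e1 * (xn * y) = 0"
    and syz2: "a2 * p + b2 * q + c2 * (x * xn) + e2 * (xn * y) = 0"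
    and syz3: "a3 * p + b3 * q + c3 * (x * xn) + e3 * (xn * y) = 0"
    and minor1: "a2 * b3 - a3 * b2 = xn * r1"
    and minor2: "a3 * b1 - a1 * b3 = xn * r2"
    and minor3: "a1 * b2 - a2 * b1 = xn * r3"
    and r1_q: "r1 * q = k * y ^ N + x * h"
    and unit_k: "k dvd 1"
    and x_ndvd_r2: "\<not> x dvd r2"
    and r2_regular: "\<And>t \<alpha> \<beta>. r2 * t = x * \<alpha> + y * \<beta> \<Longrightarrow> \<exists>\<alpha>' \<beta>'. t = x * \<alpha>' + y * \<beta>'"
    and r3_eq: "r3 = l * x"
    and unit_l: "l dvd 1"
begin

definition syz :: "'a \<Rightarrow> 'a \<Rightarrow> 'a \<Rightarrow> 'a \<Rightarrow> bool" where
  "syz a b c e \<longleftrightarrow> a * p + b * q + c * (x * xn) + e * (xn * y) = 0"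

definition spanned :: "'a \<Rightarrow> 'a \<Rightarrow> 'a \<Rightarrow> 'a \<Rightarrow> bool" where
  "spanned a b c e \<longleftrightarrow> (\<exists>u0 u1 u2 u3.
     a = a1 * u1 + a2 * u2 + a3 * u3 \<and> b = b1 * u1 + b2 * u2 + b3 * u3 \<and>
     c = y * u0 + c1 * u1 + c2 * u2 + c3 * u3 \<and> e = - (x * u0) + e1 * u1 + e2 * u2 + e3 * u3)"

lemma x_nonzero: "x \<noteq> 0"
  using prime_x by auto

lemma x_dvd_mult: "x dvd s * t \<longleftrightarrow> x dvd s \<or> x dvd t"
  using prime_x by (simp add: prime_elem_dvd_mult_iff)

lemma x_power_cancel: "xn * s = xn * t \<Longrightarrow> s = t"
  using x_nonzero by (simp add: xn_eq)

lemma syz_iff: "syz a b c e \<longleftrightarrow> a * p + b * q + xn * (c * x + e * y) = 0"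
  by (simp add: syz_def algebra_simps)

text \<open>
  The syzygies with vanishing first two entries are those of \<open>x, y\<close>, hence Koszul.
\<close>
lemma syz_zero_zero:
  assumes "syz 0 0 c e"
  obtains s where "c = y * s" "e = - (x * s)"
proof -
  have "xn * (c * x + e * y) = xn * 0"
    using assms by (simp add: syz_iff)
  then have *: "c * x + e * y = 0" by (rule x_power_cancel)
  then have "e * y = x * (- c)" by Groebner_Basis.algebra
  then have "x dvd e * y" by (metis dvd_triv_left)
  then obtain s where s: "e = x * s" using x_ndvd_y by (auto simp: x_dvd_mult)
  have "x * (c + s * y) = 0" using * s by Groebner_Basis.algebra
  then have "c + s * y = 0" using x_nonzero by simp
  then have "c = y * (- s)" by Groebner_Basis.algebra
  then show ?thesis using s by (intro that[of "- s"]) auto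
qed

lemma syz_diff_generators:
  assumes "syz a b c e"
  shows "syz (a - (a1 * u1 + a2 * u2 + a3 * u3)) (b - (b1 * u1 + b2 * u2 + b3 * u3))
             (c - (c1 * u1 + c2 * u2 + c3 * u3)) (e - (e1 * u1 + e2 * u2 + e3 * u3))"
proof -
  have "(a - (a1 * u1 + a2 * u2 + a3 * u3)) * p + (b - (b1 * u1 + b2 * u2 + b3 * u3)) * q
      + (c - (c1 * u1 + c2 * u2 + c3 * u3)) * (x * xn) + (e - (e1 * u1 + e2 * u2 + e3 * u3)) * (xn * y)
    = (a * p + b * q + c * (x * xn) + e * (xn * y))
      - (u1 * (a1 * p + b1 * q + c1 * (x * xn) + e1 * (xn * y))
       + u2 * (a2 * p + b2 * q + c2 * (x * xn) + e2 * (xn * y))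
       + u3 * (a3 * p + b3 * q + c3 * (x * xn) + e3 * (xn * y)))"
    by (simp add: algebra_simps)
  then show ?thesis using assms by (simp only: syz_def syz1 syz2 syz3) simp
qed

text \<open>
  By the previous lemma only the first two entries matter for being generated.
\<close>
lemma spanned_if_top_spanned:
  assumes "syz a b c e" "a = a1 * u1 + a2 * u2 + a3 * u3" "b = b1 * u1 + b2 * u2 + b3 * u3"
  shows "spanned a b c e"
proof -
  have "syz 0 0 (c - (c1 * u1 + c2 * u2 + c3 * u3)) (e - (e1 * u1 + e2 * u2 + e3 * u3))"
    using syz_diff_generators[OF assms(1), of u1 u2 u3] assms(2,3) by simp
  then obtain s where s: "c - (c1 * u1 + c2 * u2 + c3 * u3) = y * s"
    "e - (e1 * u1 + e2 * u2 + e3 * u3) = - (x * s)" by (rule syz_zero_zero)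
  show ?thesis unfolding spanned_def
    by (rule exI[of _ s], rule exI[of _ u1], rule exI[of _ u2], rule exI[of _ u3])
       (use assms s in \<open>auto simp: algebra_simps\<close>)
qed

text \<open>
  Expanding a \<open>3 \<times> 3\<close> determinant with a repeated row shows that the minors are a relation.
\<close>
lemma top_relation: "a1 * r1 + a2 * r2 + a3 * r3 = 0" "b1 * r1 + b2 * r2 + b3 * r3 = 0"
proof -
  have "xn * (a1 * r1 + a2 * r2 + a3 * r3) = xn * 0"
    using minor1 minor2 minor3 by Groebner_Basis.algebra
  then show "a1 * r1 + a2 * r2 + a3 * r3 = 0" by (rule x_power_cancel)
  have "xn * (b1 * r1 + b2 * r2 + b3 * r3) = xn * 0"
    using minor1 minor2 minor3 by Groebner_Basis.algebra
  then show "b1 * r1 + b2 * r2 + b3 * r3 = 0" by (rule x_power_cancel)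
qed

lemma relation_exists:
  obtains r0 where "c1 * r1 + c2 * r2 + c3 * r3 + y * r0 = 0"
    "e1 * r1 + e2 * r2 + e3 * r3 = x * r0"
proof -
  have "syz 0 0 0 0" by (simp add: syz_def)
  from syz_diff_generators[OF this, of r1 r2 r3] top_relation
  have "syz 0 0 (- (c1 * r1 + c2 * r2 + c3 * r3)) (- (e1 * r1 + e2 * r2 + e3 * r3))"
    by simp
  then obtain s where s: "- (c1 * r1 + c2 * r2 + c3 * r3) = y * s"
    "- (e1 * r1 + e2 * r2 + e3 * r3) = - (x * s)" by (rule syz_zero_zero)
  have "c1 * r1 + c2 * r2 + c3 * r3 + y * s = 0" using s(1) by Groebner_Basis.algebra
  moreover have "e1 * r1 + e2 * r2 + e3 * r3 = x * s" using s(2) by Groebner_Basis.algebra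
  ultimately show ?thesis by (rule that)
qed

text \<open>
  A relation \<open>u\<close> is proportional to \<open>r\<close>, since the columns of the \<open>2 \<times> 3\<close> block have only one relation over
  the fraction field. In \<open>r\<^sub>2u\<^sub>3 = r\<^sub>3u\<^sub>2\<close> the prime \<open>x\<close> divides \<open>r\<^sub>3\<close> but not \<open>r\<^sub>2\<close>, so it divides \<open>u\<^sub>3\<close>; that makes
  the factor of proportionality a ring element.
\<close>
lemma kernel_of_generators:
  assumes r0: "c1 * r1 + c2 * r2 + c3 * r3 + y * r0 = 0" "e1 * r1 + e2 * r2 + e3 * r3 = x * r0"
    and a: "a1 * u1 + a2 * u2 + a3 * u3 = 0" and b: "b1 * u1 + b2 * u2 + b3 * u3 = 0"
    and c: "y * u0 + c1 * u1 + c2 * u2 + c3 * u3 = 0"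
    and e: "- (x * u0) + e1 * u1 + e2 * u2 + e3 * u3 = 0"
  obtains t where "u0 = r0 * t" "u1 = r1 * t" "u2 = r2 * t" "u3 = r3 * t"
proof -
  have "xn * (r1 * u3) = xn * (r3 * u1)" using a b minor1 minor3 by Groebner_Basis.algebra
  then have 13: "r1 * u3 = r3 * u1" by (rule x_power_cancel)
  have "xn * (r2 * u3) = xn * (r3 * u2)" using a b minor2 minor3 by Groebner_Basis.algebra
  then have 23: "r2 * u3 = r3 * u2" by (rule x_power_cancel)
  have l0: "l \<noteq> 0" using unit_l by auto
  obtain l' where l': "1 = l * l'" using unit_l by (rule dvdE)
  have "x dvd r2 * u3" unfolding 23 r3_eq by simp
  then obtain s where s: "u3 = x * s" using x_ndvd_r2 by (auto simp: x_dvd_mult)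
  define t where "t = l' * s"
  have 3: "u3 = r3 * t" using l' s unfolding t_def r3_eq by Groebner_Basis.algebra
  have r30: "r3 \<noteq> 0" using l0 x_nonzero by (simp add: r3_eq)
  have "r3 * u1 = r3 * (r1 * t)" using 13 3 by Groebner_Basis.algebra
  then have 1: "u1 = r1 * t" using r30 by simp
  have "r3 * u2 = r3 * (r2 * t)" using 23 3 by Groebner_Basis.algebra
  then have 2: "u2 = r2 * t" using r30 by simp
  have "x * u0 = (e1 * r1 + e2 * r2 + e3 * r3) * t" using e unfolding 1 2 3 by Groebner_Basis.algebra
  also have "\<dots> = x * (r0 * t)" by (simp add: r0(2) mult.assoc)
  finally have "x * u0 = x * (r0 * t)" .
  then have "u0 = r0 * t" using x_nonzero by simp
  then show ?thesis using 1 2 3 by (rule that)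
qed

text \<open>
  Cramer's rule for the first two generators, whose minor is \<open>x\<^bsup>n+1\<^esup>\<close> up to a unit.
\<close>
lemma x_power_spanned:
  assumes "syz a b c e"
  shows "spanned (x * xn * a) (x * xn * b) (x * xn * c) (x * xn * e)"
proof -
  obtain l' where l': "1 = l * l'" using unit_l by (rule dvdE)
  have m: "x * xn = l' * (a1 * b2 - a2 * b1)"
    using l' minor3 r3_eq by Groebner_Basis.algebra
  show ?thesis
  proof (rule spanned_if_top_spanned)
    show "syz (x * xn * a) (x * xn * b) (x * xn * c) (x * xn * e)"
      using assms unfolding syz_def by Groebner_Basis.algebra
    show "x * xn * a = a1 * (l' * (a * b2 - b * a2)) + a2 * (l' * (a1 * b - b1 * a)) + a3 * 0"
      unfolding m by Groebner_Basis.algebra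
    show "x * xn * b = b1 * (l' * (a * b2 - b * a2)) + b2 * (l' * (a1 * b - b1 * a)) + b3 * 0"
      unfolding m by Groebner_Basis.algebra
  qed
qed

text \<open>
  Cramer's rule for the last two generators alone only gives the multiple by the minor \<open>x\<^bsup>n\<^esup>r\<^sub>1\<close>. After
  multiplication by \<open>q\<close> the syzygy equations replace \<open>bq\<close> and \<open>b\<^sub>iq\<close>, the terms in \<open>p\<close> cancel, and the
  Cramer coefficients become divisible by \<open>x\<^bsup>n\<^esup>\<close>.
\<close>
lemma r1_q_spanned:
  assumes s: "syz a b c e"
  shows "spanned (r1 * q * a) (r1 * q * b) (r1 * q * c) (r1 * q * e)"
proof (rule spanned_if_top_spanned)
  show "syz (r1 * q * a) (r1 * q * b) (r1 * q * c) (r1 * q * e)"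
    using s unfolding syz_def by Groebner_Basis.algebra
  define u2 where "u2 = a3 * (c * x + e * y) - a * (c3 * x + e3 * y)"
  define u3 where "u3 = a * (c2 * x + e2 * y) - a2 * (c * x + e * y)"
  have tail: "xn * (c * x + e * y) = - (a * p + b * q)"
    "xn * (c2 * x + e2 * y) = - (a2 * p + b2 * q)" "xn * (c3 * x + e3 * y) = - (a3 * p + b3 * q)"
    using s syz2 syz3 unfolding syz_def by Groebner_Basis.algebra+
  have "xn * u2 = a3 * (xn * (c * x + e * y)) - a * (xn * (c3 * x + e3 * y))"
    unfolding u2_def by Groebner_Basis.algebra
  also have "\<dots> = q * (a * b3 - b * a3)" unfolding tail by Groebner_Basis.algebra
  finally have 2: "xn * u2 = q * (a * b3 - b * a3)" .
  have "xn * u3 = a * (xn * (c2 * x + e2 * y)) - a2 * (xn * (c * x + e * y))"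
    unfolding u3_def by Groebner_Basis.algebra
  also have "\<dots> = q * (a2 * b - b2 * a)" unfolding tail by Groebner_Basis.algebra
  finally have 3: "xn * u3 = q * (a2 * b - b2 * a)" .
  have "xn * (r1 * q * a) = (a2 * b3 - a3 * b2) * q * a" unfolding minor1 by Groebner_Basis.algebra
  also have "\<dots> = a2 * (xn * u2) + a3 * (xn * u3)" unfolding 2 3 by Groebner_Basis.algebra
  also have "\<dots> = xn * (a1 * 0 + a2 * u2 + a3 * u3)" by Groebner_Basis.algebra
  finally show "r1 * q * a = a1 * 0 + a2 * u2 + a3 * u3" by (rule x_power_cancel)
  have "xn * (r1 * q * b) = (a2 * b3 - a3 * b2) * q * b" unfolding minor1 by Groebner_Basis.algebra
  also have "\<dots> = b2 * (xn * u2) + b3 * (xn * u3)" unfolding 2 3 by Groebner_Basis.algebra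
  also have "\<dots> = xn * (b1 * 0 + b2 * u2 + b3 * u3)" by Groebner_Basis.algebra
  finally show "r1 * q * b = b1 * 0 + b2 * u2 + b3 * u3" by (rule x_power_cancel)
qed

text \<open>
  Regularity modulo \<open>(x, y)\<close> passes to \<open>(x, y\<^bsup>M\<^esup>)\<close>, because \<open>y\<close> is regular modulo the prime \<open>x\<close>.
\<close>
lemma r2_regular_power:
  assumes "r2 * t = x * \<alpha> + y ^ M * \<beta>"
  shows "\<exists>\<alpha>' \<beta>'. t = x * \<alpha>' + y ^ M * \<beta>'"
  using assms
proof (induction M arbitrary: t \<alpha> \<beta>)
  case 0
  then show ?case by (intro exI[of _ 0] exI[of _ t]) simp
next
  case (Suc M)
  have "r2 * t = x * \<alpha> + y * (y ^ M * \<beta>)" using Suc.prems by (simp add: algebra_simps)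
  from r2_regular[OF this] obtain \<alpha>1 \<beta>1 where t: "t = x * \<alpha>1 + y * \<beta>1" by blast
  have "y * (r2 * \<beta>1 - y ^ M * \<beta>) = x * (\<alpha> - r2 * \<alpha>1)"
    using Suc.prems by (simp add: t algebra_simps)
  then have "x dvd y * (r2 * \<beta>1 - y ^ M * \<beta>)" by simp
  then obtain s where "r2 * \<beta>1 - y ^ M * \<beta> = x * s" using x_ndvd_y by (auto simp: x_dvd_mult)
  then have "r2 * \<beta>1 = x * s + y ^ M * \<beta>" by (simp add: diff_eq_eq)
  from Suc.IH[OF this] obtain \<alpha>2 \<beta>2 where "\<beta>1 = x * \<alpha>2 + y ^ M * \<beta>2" by blast
  then have "t = x * (\<alpha>1 + y * \<alpha>2) + y ^ Suc M * \<beta>2" by (simp add: t algebra_simps)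
  then show ?case by blast
qed

text \<open>
  The heart of exactness. Let \<open>M\<close> be the matrix of the generators, and write \<open>xv = Mu\<close> and \<open>\<rho>v = Mw\<close> with
  \<open>\<rho> = r\<^sub>1q\<close>. Then \<open>\<rho>u - xw\<close> is a relation, so it equals \<open>tr\<close>. Its entry at \<open>r\<^sub>2\<close> shows \<open>r\<^sub>2t \<in> (x, y\<^bsup>N\<^esup>)\<close>,
  hence \<open>t \<in> (x, y\<^bsup>N\<^esup>)\<close>. As \<open>\<rho>\<close> is \<open>y\<^bsup>N\<^esup>\<close> up to a unit modulo \<open>x\<close>, subtracting a multiple of the relation \<open>r\<close>
  from \<open>u\<close> makes it divisible by \<open>x\<close>, and \<open>x\<close> cancels in \<open>xv = Mu\<close>.
\<close>
lemma spanned_cancel_x: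
  assumes v: "syz a b c e" and xv: "spanned (x * a) (x * b) (x * c) (x * e)"
  shows "spanned a b c e"
proof -
  define \<rho> where "\<rho> = r1 * q"
  obtain r0 where r0: "c1 * r1 + c2 * r2 + c3 * r3 + y * r0 = 0"
    "e1 * r1 + e2 * r2 + e3 * r3 = x * r0" by (rule relation_exists)
  obtain u0 u1 u2 u3 where u: "x * a = a1 * u1 + a2 * u2 + a3 * u3"
    "x * b = b1 * u1 + b2 * u2 + b3 * u3" "x * c = y * u0 + c1 * u1 + c2 * u2 + c3 * u3"
    "x * e = - (x * u0) + e1 * u1 + e2 * u2 + e3 * u3"
    using xv unfolding spanned_def by blast
  obtain w0 w1 w2 w3 where w: "\<rho> * a = a1 * w1 + a2 * w2 + a3 * w3"
    "\<rho> * b = b1 * w1 + b2 * w2 + b3 * w3"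
    "\<rho> * c = y * w0 + c1 * w1 + c2 * w2 + c3 * w3"
    "\<rho> * e = - (x * w0) + e1 * w1 + e2 * w2 + e3 * w3"
    using r1_q_spanned[OF v, folded \<rho>_def] unfolding spanned_def by blast
  obtain t where t: "\<rho> * u0 - x * w0 = r0 * t" "\<rho> * u1 - x * w1 = r1 * t"
    "\<rho> * u2 - x * w2 = r2 * t" "\<rho> * u3 - x * w3 = r3 * t"
  proof (rule kernel_of_generators[OF r0])
    have "a1 * (\<rho> * u1 - x * w1) + a2 * (\<rho> * u2 - x * w2) + a3 * (\<rho> * u3 - x * w3)
        = \<rho> * (a1 * u1 + a2 * u2 + a3 * u3) - x * (a1 * w1 + a2 * w2 + a3 * w3)"
      by (simp add: algebra_simps)
    then show "a1 * (\<rho> * u1 - x * w1) + a2 * (\<rho> * u2 - x * w2) + a3 * (\<rho> * u3 - x * w3) = 0"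
      by (simp flip: u w)
    have "b1 * (\<rho> * u1 - x * w1) + b2 * (\<rho> * u2 - x * w2) + b3 * (\<rho> * u3 - x * w3)
        = \<rho> * (b1 * u1 + b2 * u2 + b3 * u3) - x * (b1 * w1 + b2 * w2 + b3 * w3)"
      by (simp add: algebra_simps)
    then show "b1 * (\<rho> * u1 - x * w1) + b2 * (\<rho> * u2 - x * w2) + b3 * (\<rho> * u3 - x * w3) = 0"
      by (simp flip: u w)
    have "y * (\<rho> * u0 - x * w0) + c1 * (\<rho> * u1 - x * w1) + c2 * (\<rho> * u2 - x * w2)
          + c3 * (\<rho> * u3 - x * w3)
        = \<rho> * (y * u0 + c1 * u1 + c2 * u2 + c3 * u3) - x * (y * w0 + c1 * w1 + c2 * w2 + c3 * w3)"
      by (simp add: algebra_simps)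
    then show "y * (\<rho> * u0 - x * w0) + c1 * (\<rho> * u1 - x * w1) + c2 * (\<rho> * u2 - x * w2)
        + c3 * (\<rho> * u3 - x * w3) = 0"
      by (simp flip: u w)
    have "- (x * (\<rho> * u0 - x * w0)) + e1 * (\<rho> * u1 - x * w1) + e2 * (\<rho> * u2 - x * w2)
          + e3 * (\<rho> * u3 - x * w3)
        = \<rho> * (- (x * u0) + e1 * u1 + e2 * u2 + e3 * u3)
          - x * (- (x * w0) + e1 * w1 + e2 * w2 + e3 * w3)"
      by (simp add: algebra_simps)
    also have "\<dots> = \<rho> * (x * e) - x * (\<rho> * e)" by (simp only: u(4) w(4))
    finally show "- (x * (\<rho> * u0 - x * w0)) + e1 * (\<rho> * u1 - x * w1) + e2 * (\<rho> * u2 - x * w2)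
        + e3 * (\<rho> * u3 - x * w3) = 0"
      by simp
  qed
  obtain yN where yN: "yN = y ^ N" by blast
  have r1_q': "\<rho> = k * yN + x * h" using r1_q yN by (simp add: \<rho>_def)
  have "r2 * t = x * (h * u2 - w2) + yN * (k * u2)" using t(3) r1_q' by Groebner_Basis.algebra
  then have "r2 * t = x * (h * u2 - w2) + y ^ N * (k * u2)" by (simp only: yN)
  from r2_regular_power[OF this] obtain t2 t1 where t12: "t = x * t2 + yN * t1"
    unfolding yN by blast
  obtain k' where k': "1 = k * k'" using unit_k by (rule dvdE)
  have split: "\<exists>s. u = R * (k' * t1) + x * s" if "\<rho> * u - x * w = R * t" for u w R
  proof -
    have "yN * (k * u - R * t1) = x * (w + R * t2 - h * u)"
      using that r1_q' t12 by Groebner_Basis.algebra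
    then have "x dvd yN * (k * u - R * t1)" by simp
    then have "x dvd k * u - R * t1"
      using x_ndvd_y prime_x by (auto simp: x_dvd_mult yN dest: prime_elem_dvd_power)
    then obtain s where "k * u - R * t1 = x * s" by blast
    then have "u = R * (k' * t1) + x * (k' * s)" using k' by Groebner_Basis.algebra
    then show ?thesis by blast
  qed
  obtain s0 s1 s2 s3 where s: "u0 = r0 * (k' * t1) + x * s0" "u1 = r1 * (k' * t1) + x * s1"
    "u2 = r2 * (k' * t1) + x * s2" "u3 = r3 * (k' * t1) + x * s3"
    using split[OF t(1)] split[OF t(2)] split[OF t(3)] split[OF t(4)] by blast
  have "x * a = (a1 * r1 + a2 * r2 + a3 * r3) * (k' * t1) + x * (a1 * s1 + a2 * s2 + a3 * s3)"
    unfolding u(1) s by (simp add: algebra_simps)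
  moreover have "x * b = (b1 * r1 + b2 * r2 + b3 * r3) * (k' * t1) + x * (b1 * s1 + b2 * s2 + b3 * s3)"
    unfolding u(2) s by (simp add: algebra_simps)
  ultimately show ?thesis
    using x_nonzero top_relation by (intro spanned_if_top_spanned[OF v, of s1 s2 s3]) simp_all
qed

text \<open>
  A high power of \<open>x\<close> brings every syzygy into the span; the factors \<open>x\<close> are then removed one by one.
\<close>
lemma syz_imp_spanned:
  assumes "syz a b c e"
  shows "spanned a b c e"
proof -
  have "spanned a b c e" if "spanned (x ^ M * a) (x ^ M * b) (x ^ M * c) (x ^ M * e)" for M
    using that
  proof (induction M)
    case 0
    then show ?case by simp
  next
    case (Suc M)
    have "syz (x ^ M * a) (x ^ M * b) (x ^ M * c) (x ^ M * e)"
      using assms unfolding syz_def by (simp add: mult.assoc flip: distrib_left)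
    then have "spanned (x ^ M * a) (x ^ M * b) (x ^ M * c) (x ^ M * e)"
      by (rule spanned_cancel_x) (use Suc.prems in \<open>simp add: mult.assoc\<close>)
    then show ?case by (rule Suc.IH)
  qed
  moreover have "x * xn = x ^ Suc n" by (simp add: xn_eq)
  ultimately show ?thesis using x_power_spanned[OF assms] by metis
qed

lemma spanned_imp_syz:
  assumes "spanned a b c e"
  shows "syz a b c e"
proof -
  obtain u0 u1 u2 u3 where u: "a = a1 * u1 + a2 * u2 + a3 * u3"
    "b = b1 * u1 + b2 * u2 + b3 * u3" "c = y * u0 + c1 * u1 + c2 * u2 + c3 * u3"
    "e = - (x * u0) + e1 * u1 + e2 * u2 + e3 * u3"
    using assms unfolding spanned_def by blast
  have "syz 0 0 (y * u0) (- (x * u0))" by (simp add: syz_def algebra_simps)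
  from syz_diff_generators[OF this, of "- u1" "- u2" "- u3"] show ?thesis
    by (simp add: u algebra_simps)
qed

end

section \<open>From a syzygy block to a minimal resolution\<close>

(* From here on the dollar sign indexes vectors with carrier. *)
unbundle no vec_syntax

lemma all_less_four: "(\<forall>i<4::nat. P i) \<longleftrightarrow> P 0 \<and> P 1 \<and> P 2 \<and> P 3"
  by (auto simp: numeral_eq_Suc less_Suc_eq)

lemma all_less_three: "(\<forall>i<3::nat. P i) \<longleftrightarrow> P 0 \<and> P 1 \<and> P 2"
  by (auto simp: numeral_eq_Suc less_Suc_eq)

lemma vec_four_eqI:
  assumes "v \<in> carrier_vec 4" "w \<in> carrier_vec 4" "v $ 0 = w $ 0" "v $ 1 = w $ 1" "v $ 2 = w $ 2" "v $ 3 = w $ 3"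
  shows "v = w"
  using assms all_less_four[of "\<lambda>i. v $ i = w $ i"] by (intro eq_vecI) auto

lemma vec_one_eqI:
  assumes "v \<in> carrier_vec 1" "w \<in> carrier_vec 1" "v $ 0 = w $ 0"
  shows "v = w"
  using assms by (intro eq_vecI) auto

lemma mult_rows_four:
  fixes u :: "'a::comm_semiring_1 vec"
  assumes "u \<in> carrier_vec 4" "i < length L"
  shows "(mat_of_rows_list 4 L *\<^sub>v u) $ i =
     L ! i ! 0 * u $ 0 + L ! i ! 1 * u $ 1 + L ! i ! 2 * u $ 2 + L ! i ! 3 * u $ 3"
proof -
  have "{0..<4::nat} = {0, 1, 2, 3}" by auto
  then show ?thesis
    using assms by (simp add: mat_of_rows_list_def scalar_prod_def add.assoc)
qed

lemma mult_rows_one: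
  fixes u :: "'a::comm_semiring_1 vec"
  assumes "u \<in> carrier_vec 1" "i < length L"
  shows "(mat_of_rows_list 1 L *\<^sub>v u) $ i = L ! i ! 0 * u $ 0"
  using assms by (simp add: mat_of_rows_list_def scalar_prod_def)

lemma mat_of_rows_list_entry:
  "i < length L \<Longrightarrow> j < m \<Longrightarrow> mat_of_rows_list m L $$ (i, j) = L ! i ! j"
  by (simp add: mat_of_rows_list_def)

lemma mat_of_rows_list_dims [simp]:
  "dim_row (mat_of_rows_list m L) = length L" "dim_col (mat_of_rows_list m L) = m"
  by (simp_all add: mat_of_rows_list_def)

lemma jacobian_ideal_iff:
  "s \<in> jacobian_ideal f \<longleftrightarrow> (\<exists>s0 s1 s2 s3. s = partial_deriv 0 f * s0 + partial_deriv 1 f * s1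
     + partial_deriv 2 f * s2 + partial_deriv 3 f * s3)"
proof
  assume "s \<in> jacobian_ideal f"
  then show "\<exists>s0 s1 s2 s3. s = partial_deriv 0 f * s0 + partial_deriv 1 f * s1
     + partial_deriv 2 f * s2 + partial_deriv 3 f * s3"
    unfolding jacobian_ideal_def sum_four by (auto simp: mult.commute)
next
  assume "\<exists>s0 s1 s2 s3. s = partial_deriv 0 f * s0 + partial_deriv 1 f * s1
     + partial_deriv 2 f * s2 + partial_deriv 3 f * s3"
  then obtain s0 s1 s2 s3 where s: "s = partial_deriv 0 f * s0 + partial_deriv 1 f * s1
     + partial_deriv 2 f * s2 + partial_deriv 3 f * s3" by blast
  let ?a = "\<lambda>i::4. if i = 0 then s0 else if i = 1 then s1 else if i = 2 then s2 else s3"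
  have "s = (\<Sum>i\<in>UNIV. ?a i * partial_deriv i f)"
    unfolding sum_four s by (simp add: mult.commute)
  then show "s \<in> jacobian_ideal f" unfolding jacobian_ideal_def by (auto intro!: exI[of _ ?a])
qed

lemma residue_class_jacobian_ideal:
  "residue_class (jacobian_ideal f) s = jacobian_ideal f \<longleftrightarrow> s \<in> jacobian_ideal f"
proof
  have zero: "0 \<in> jacobian_ideal f"
    unfolding jacobian_ideal_def by (auto intro!: exI[of _ "\<lambda>_. 0"])
  assume "residue_class (jacobian_ideal f) s = jacobian_ideal f"
  moreover have "s + 0 \<in> residue_class (jacobian_ideal f) s"
    unfolding residue_class_def using zero by blast
  ultimately show "s \<in> jacobian_ideal f" by simp
next
  assume "s \<in> jacobian_ideal f"
  then obtain a where a: "s = (\<Sum>i\<in>UNIV. a i * partial_deriv i f)"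
    unfolding jacobian_ideal_def by blast
  show "residue_class (jacobian_ideal f) s = jacobian_ideal f"
  proof (intro equalityI subsetI)
    fix t assume "t \<in> residue_class (jacobian_ideal f) s"
    then obtain b where "t = s + (\<Sum>i\<in>UNIV. b i * partial_deriv i f)"
      unfolding residue_class_def jacobian_ideal_def by blast
    then have "t = (\<Sum>i\<in>UNIV. (a i + b i) * partial_deriv i f)"
      by (simp add: a distrib_right sum.distrib)
    then show "t \<in> jacobian_ideal f" unfolding jacobian_ideal_def by (auto intro!: exI[of _ "\<lambda>i. a i + b i"])
  next
    fix t assume "t \<in> jacobian_ideal f"
    then obtain b where "t = (\<Sum>i\<in>UNIV. b i * partial_deriv i f)"
      unfolding jacobian_ideal_def by blast
    then have "t = s + (\<Sum>i\<in>UNIV. (b i - a i) * partial_deriv i f)"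
      by (simp add: a left_diff_distrib sum_subtractf)
    then show "t \<in> residue_class (jacobian_ideal f) s"
      unfolding residue_class_def jacobian_ideal_def by (auto intro!: exI[of _ "\<lambda>i. b i - a i"])
  qed
qed

text \<open>
  If all degree differences are positive, a matrix with entries of these degrees is automatically minimal.
\<close>
lemma minimal_graded_hom_rows:
  assumes "list_all2 (\<lambda>a row. list_all2 (\<lambda>b s. a < b \<and> homogeneous (b - a) s) bs row) as L"
    and "A = mat_of_rows_list (length bs) L"
  shows "graded_hom bs as A"
    and "\<forall>i<length as. \<forall>j<length bs. Poly_Mapping.lookup (A $$ (i, j)) 0 = 0"
proof -
  have len: "length L = length as" using assms(1) by (simp add: list_all2_lengthD)
  have entry: "as ! i < bs ! j \<and> homogeneous (bs ! j - as ! i) (A $$ (i, j))"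
    if "i < length as" "j < length bs" for i j
  proof -
    have "list_all2 (\<lambda>b s. as ! i < b \<and> homogeneous (b - as ! i) s) bs (L ! i)"
      using list_all2_nthD[OF assms(1) that(1)] .
    from list_all2_nthD[OF this that(2)] show ?thesis
      using that len by (simp add: assms(2) mat_of_rows_list_entry)
  qed
  then show "graded_hom bs as A"
    unfolding graded_hom_def using len by (auto simp: assms(2) less_imp_le intro!: carrier_matI)
  show "\<forall>i<length as. \<forall>j<length bs. Poly_Mapping.lookup (A $$ (i, j)) 0 = 0"
  proof (intro allI impI)
    fix i j assume "i < length as" "j < length bs"
    from entry[OF this] show "Poly_Mapping.lookup (A $$ (i, j)) 0 = 0"
      using homogeneous_constant_term[of "bs ! j - as ! i"] by simp
  qed
qed

text \<open>
  The syzygy block is the resolution: the maps are the row of partial derivatives, the matrix of the four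
  generating syzygies and the column of the relation. Here \<open>d2\<close> and \<open>d3\<close> are the degrees of the generators.
  The entry \<open>r\<^sub>0\<close> of the relation is only known to exist; its degree is read off from \<open>xr\<^sub>0 = \<Sum>e\<^sub>ir\<^sub>i\<close>.
\<close>
lemma nearly_freeI:
  fixes f p q a1 a2 a3 b1 b2 b3 c1 c2 c3 e1 e2 e3 r1 r2 r3 k l h :: S
  assumes f: "homogeneous (n + 2) f" "squarefree f" "\<not> is_cone f"
    and partials: "partial_deriv 0 f = p" "partial_deriv 1 f = q"
      "partial_deriv 2 f = xv * xv ^ n" "partial_deriv 3 f = xv ^ n * yv"
    and block: "syzygy_block xv yv p q (xv ^ n) n N a1 a2 a3 b1 b2 b3 c1 c2 c3 e1 e2 e3 r1 r2 r3 k l h"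
    and ds: "1 \<le> d2" "d2 \<le> d3"
    and hom_partials: "homogeneous (Suc n) p" "homogeneous (Suc n) q"
    and hom1: "homogeneous d2 a1" "homogeneous d2 b1" "homogeneous d2 c1" "homogeneous d2 e1"
    and hom2: "homogeneous d3 a2" "homogeneous d3 b2" "homogeneous d3 c2" "homogeneous d3 e2"
    and hom3: "homogeneous d3 a3" "homogeneous d3 b3" "homogeneous d3 c3" "homogeneous d3 e3"
    and homr: "homogeneous (Suc d3 - d2) r1" "homogeneous 1 r2" "homogeneous 1 r3"
  shows "nearly_free (n + 2) f 1 d2 d3"
proof -
  interpret syzygy_block xv yv p q "xv ^ n" n N a1 a2 a3 b1 b2 b3 c1 c2 c3 e1 e2 e3 r1 r2 r3 k l h
    by (rule block)
  obtain r0 where r0: "c1 * r1 + c2 * r2 + c3 * r3 + yv * r0 = 0"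
    "e1 * r1 + e2 * r2 + e3 * r3 = xv * r0" by (rule relation_exists)
  have "homogeneous (Suc d3) (e1 * r1 + e2 * r2 + e3 * r3)"
    using hom1 hom2 hom3 homr ds by (intro homogeneous_add homogeneous_mult) auto
  then have hom_r0: "homogeneous d3 r0"
    unfolding r0(2) by (rule homogeneous_Var_mult_cancel)
  define D0 where "D0 = mat_of_rows_list 4 [[p, q, xv * xv ^ n, xv ^ n * yv]]"
  define D1 where "D1 = mat_of_rows_list 4 [[0, a1, a2, a3], [0, b1, b2, b3], [yv, c1, c2, c3], [- xv, e1, e2, e3]]"
  define D2 where "D2 = mat_of_rows_list 1 [[r0], [r1], [r2], [r3]]"
  let ?Fs = "[[0], replicate 4 (n + 1), [1 + (n + 1), d2 + (n + 1), d3 + (n + 1), d3 + (n + 1)], [d3 + (n + 2)]]"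
  let ?J = "jacobian_ideal f"
  have dims: "dim_row D0 = 1" "dim_col D0 = 4" "dim_row D1 = 4" "dim_col D1 = 4" "dim_row D2 = 4" "dim_col D2 = 1"
    by (simp_all add: D0_def D1_def D2_def)
  have D0_mult: "(D0 *\<^sub>v u) $ 0 = p * u $ 0 + q * u $ 1 + xv * xv ^ n * u $ 2 + xv ^ n * yv * u $ 3"
    if "u \<in> carrier_vec 4" for u
    using that by (simp add: D0_def mult_rows_four del: index_mult_mat_vec)
  have D1_mult: "(D1 *\<^sub>v u) $ 0 = a1 * u $ 1 + a2 * u $ 2 + a3 * u $ 3"
    "(D1 *\<^sub>v u) $ 1 = b1 * u $ 1 + b2 * u $ 2 + b3 * u $ 3"
    "(D1 *\<^sub>v u) $ 2 = yv * u $ 0 + c1 * u $ 1 + c2 * u $ 2 + c3 * u $ 3"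
    "(D1 *\<^sub>v u) $ 3 = - (xv * u $ 0) + e1 * u $ 1 + e2 * u $ 2 + e3 * u $ 3"
    if "u \<in> carrier_vec 4" for u
    using that by (simp_all add: D1_def mult_rows_four del: index_mult_mat_vec)
  have D2_mult: "(D2 *\<^sub>v u) $ 0 = r0 * u $ 0" "(D2 *\<^sub>v u) $ 1 = r1 * u $ 0"
    "(D2 *\<^sub>v u) $ 2 = r2 * u $ 0" "(D2 *\<^sub>v u) $ 3 = r3 * u $ 0"
    if "u \<in> carrier_vec 1" for u
    using that by (simp_all add: D2_def mult_rows_one del: index_mult_mat_vec One_nat_def)
  have im0: "{u \<in> carrier_vec 1. residue_class ?J (vec 1 (\<lambda>_. 1) \<bullet> u) = ?J} = mat_image D0"
  proof (intro equalityI subsetI)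
    fix u assume "u \<in> {u \<in> carrier_vec 1. residue_class ?J (vec 1 (\<lambda>_. 1) \<bullet> u) = ?J}"
    then have u: "u \<in> carrier_vec 1" "u $ 0 \<in> ?J"
      by (auto simp: residue_class_jacobian_ideal scalar_prod_def)
    then obtain s0 s1 s2 s3 where s: "u $ 0 = p * s0 + q * s1 + xv * xv ^ n * s2 + xv ^ n * yv * s3"
      unfolding jacobian_ideal_iff partials by blast
    have w: "vec 4 (\<lambda>i. [s0, s1, s2, s3] ! i) \<in> carrier_vec 4" by (rule carrier_vecI) simp
    have "D0 *\<^sub>v vec 4 (\<lambda>i. [s0, s1, s2, s3] ! i) \<in> carrier_vec 1" by (rule carrier_vecI) (simp add: dims)
    with u(1) have "u = D0 *\<^sub>v vec 4 (\<lambda>i. [s0, s1, s2, s3] ! i)"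
      by (rule vec_one_eqI) (simp only: D0_mult[OF w] s, simp)
    with w show "u \<in> mat_image D0" unfolding mat_image_def dims by blast
  next
    fix u assume "u \<in> mat_image D0"
    then obtain v where v: "v \<in> carrier_vec 4" "u = D0 *\<^sub>v v" by (auto simp: mat_image_def dims)
    have "u \<in> carrier_vec 1" using v dims by (intro carrier_vecI) (simp del: One_nat_def)
    moreover have "u $ 0 \<in> ?J" unfolding v(2) D0_mult[OF v(1)] jacobian_ideal_iff partials by blast
    ultimately show "u \<in> {u \<in> carrier_vec 1. residue_class ?J (vec 1 (\<lambda>_. 1) \<bullet> u) = ?J}"
      by (simp add: residue_class_jacobian_ideal scalar_prod_def)
  qed
  have im1: "mat_kernel D0 = mat_image D1"
  proof (intro equalityI subsetI)
    fix u assume "u \<in> mat_kernel D0"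
    then have u: "u \<in> carrier_vec 4" "D0 *\<^sub>v u = 0\<^sub>v 1"
      by (auto simp: mat_kernel_def dims)
    then have "(D0 *\<^sub>v u) $ 0 = 0" by simp
    then have "syz (u $ 0) (u $ 1) (u $ 2) (u $ 3)"
      unfolding D0_mult[OF u(1)] syz_def by (simp add: mult_ac)
    then obtain s0 s1 s2 s3 where s: "u $ 0 = a1 * s1 + a2 * s2 + a3 * s3"
      "u $ 1 = b1 * s1 + b2 * s2 + b3 * s3" "u $ 2 = yv * s0 + c1 * s1 + c2 * s2 + c3 * s3"
      "u $ 3 = - (xv * s0) + e1 * s1 + e2 * s2 + e3 * s3"
      using syz_imp_spanned unfolding spanned_def by blast
    have w: "vec 4 (\<lambda>i. [s0, s1, s2, s3] ! i) \<in> carrier_vec 4" by (rule carrier_vecI) simp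
    have "D1 *\<^sub>v vec 4 (\<lambda>i. [s0, s1, s2, s3] ! i) \<in> carrier_vec 4" by (rule carrier_vecI) (simp add: dims)
    with u(1) have "u = D1 *\<^sub>v vec 4 (\<lambda>i. [s0, s1, s2, s3] ! i)"
      by (rule vec_four_eqI)
         (simp_all only: D1_mult[OF w] s, simp_all)
    with w show "u \<in> mat_image D1" unfolding mat_image_def dims by blast
  next
    fix u assume "u \<in> mat_image D1"
    then obtain v where v: "v \<in> carrier_vec 4" "u = D1 *\<^sub>v v" by (auto simp: mat_image_def dims)
    have u: "u \<in> carrier_vec 4" using v dims by (intro carrier_vecI) (simp del: One_nat_def)
    have "spanned (u $ 0) (u $ 1) (u $ 2) (u $ 3)"
      unfolding v(2) D1_mult[OF v(1)] spanned_def by blast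
    then have "syz (u $ 0) (u $ 1) (u $ 2) (u $ 3)" by (rule spanned_imp_syz)
    then have "(D0 *\<^sub>v u) $ 0 = 0"
      unfolding D0_mult[OF u] syz_def by (simp add: mult_ac)
    then show "u \<in> mat_kernel D0"
      using u by (auto simp: mat_kernel_def dims intro!: eq_vecI)
  qed
  have im2: "mat_kernel D1 = mat_image D2"
  proof (intro equalityI subsetI)
    fix u assume "u \<in> mat_kernel D1"
    then have u: "u \<in> carrier_vec 4" "D1 *\<^sub>v u = 0\<^sub>v 4"
      by (auto simp: mat_kernel_def dims)
    have *: "(D1 *\<^sub>v u) $ 0 = 0" "(D1 *\<^sub>v u) $ 1 = 0" "(D1 *\<^sub>v u) $ 2 = 0" "(D1 *\<^sub>v u) $ 3 = 0"
      unfolding u(2) by simp_all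
    obtain t where t: "u $ 0 = r0 * t" "u $ 1 = r1 * t" "u $ 2 = r2 * t" "u $ 3 = r3 * t"
      by (rule kernel_of_generators[OF r0 *[unfolded D1_mult[OF u(1)]]])
    have w: "vec 1 (\<lambda>_. t) \<in> carrier_vec 1" by simp
    have "D2 *\<^sub>v vec 1 (\<lambda>_. t) \<in> carrier_vec 4" by (rule carrier_vecI) (simp add: dims)
    with u(1) have "u = D2 *\<^sub>v vec 1 (\<lambda>_. t)"
      by (rule vec_four_eqI) (simp_all only: D2_mult[OF w] t, simp_all)
    with w show "u \<in> mat_image D2" unfolding mat_image_def dims by blast
  next
    fix u assume "u \<in> mat_image D2"
    then obtain v where v: "v \<in> carrier_vec 1" "u = D2 *\<^sub>v v" by (auto simp: mat_image_def dims)
    have u: "u \<in> carrier_vec 4" using v dims by (intro carrier_vecI) (simp del: One_nat_def)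
    have comps: "u $ 0 = r0 * v $ 0" "u $ 1 = r1 * v $ 0" "u $ 2 = r2 * v $ 0" "u $ 3 = r3 * v $ 0"
      unfolding v(2) D2_mult[OF v(1)] by simp_all
    have "D1 *\<^sub>v u = 0\<^sub>v 4"
    proof (rule vec_four_eqI)
      show "D1 *\<^sub>v u \<in> carrier_vec 4" by (rule carrier_vecI) (simp add: dims)
      have "(D1 *\<^sub>v u) $ 0 = (a1 * r1 + a2 * r2 + a3 * r3) * v $ 0"
        unfolding D1_mult[OF u] comps by (simp add: algebra_simps)
      then show "(D1 *\<^sub>v u) $ 0 = 0\<^sub>v 4 $ 0" by (simp only: top_relation) simp
      have "(D1 *\<^sub>v u) $ 1 = (b1 * r1 + b2 * r2 + b3 * r3) * v $ 0"
        unfolding D1_mult[OF u] comps by (simp add: algebra_simps)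
      then show "(D1 *\<^sub>v u) $ 1 = 0\<^sub>v 4 $ 1" by (simp only: top_relation) simp
      have "(D1 *\<^sub>v u) $ 2 = (c1 * r1 + c2 * r2 + c3 * r3 + yv * r0) * v $ 0"
        unfolding D1_mult[OF u] comps by (simp add: algebra_simps)
      then show "(D1 *\<^sub>v u) $ 2 = 0\<^sub>v 4 $ 2" by (simp only: r0) simp
      have "(D1 *\<^sub>v u) $ 3 = ((e1 * r1 + e2 * r2 + e3 * r3) - xv * r0) * v $ 0"
        unfolding D1_mult[OF u] comps by (simp add: algebra_simps)
      then show "(D1 *\<^sub>v u) $ 3 = 0\<^sub>v 4 $ 3" by (simp only: r0) simp
    qed simp
    then show "u \<in> mat_kernel D1" using u by (simp add: mat_kernel_def dims)
  qed
  have r3_nonzero: "r3 \<noteq> 0" using r3_eq unit_l by auto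
  have im3: "mat_kernel D2 = {0\<^sub>v 1}"
  proof (intro equalityI subsetI)
    fix u assume "u \<in> mat_kernel D2"
    then have u: "u \<in> carrier_vec 1" "D2 *\<^sub>v u = 0\<^sub>v 4"
      by (auto simp: mat_kernel_def dims)
    then have "(D2 *\<^sub>v u) $ 3 = 0" by simp
    then have "u $ 0 = 0" unfolding D2_mult[OF u(1)] using r3_nonzero by simp
    then have "u = 0\<^sub>v 1" using u by (intro eq_vecI) auto
    then show "u \<in> {0\<^sub>v 1}" by simp
  next
    fix u :: "S vec" assume "u \<in> {0\<^sub>v 1}"
    then have u: "u = 0\<^sub>v 1" by simp
    then have w: "u \<in> carrier_vec 1" by simp
    have "D2 *\<^sub>v u \<in> carrier_vec 4" by (rule carrier_vecI) (simp add: dims)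
    then have "D2 *\<^sub>v u = 0\<^sub>v 4"
      by (rule vec_four_eqI) (simp_all only: D2_mult[OF w], simp_all add: u)
    then show "u \<in> mat_kernel D2" using w by (simp add: mat_kernel_def dims)
  qed
  have hom0: "homogeneous (Suc n) (xv * xv ^ n)" "homogeneous (Suc n) (xv ^ n * yv)"
    by (rule homogeneous_intros | rule refl | simp)+
  have rows0: "list_all2 (\<lambda>a row. list_all2 (\<lambda>b s. a < b \<and> homogeneous (b - a) s) (replicate 4 (n + 1)) row)
      [0] [[p, q, xv * xv ^ n, xv ^ n * yv]]"
    using hom_partials hom0 by (simp add: numeral_eq_Suc)
  have rows1: "list_all2 (\<lambda>a row. list_all2 (\<lambda>b s. a < b \<and> homogeneous (b - a) s)
        [1 + (n + 1), d2 + (n + 1), d3 + (n + 1), d3 + (n + 1)] row)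
      (replicate 4 (n + 1)) [[0, a1, a2, a3], [0, b1, b2, b3], [yv, c1, c2, c3], [- xv, e1, e2, e3]]"
    using hom1 hom2 hom3 ds homogeneous_Var[of 0] homogeneous_Var[of 1]
    by (simp add: numeral_eq_Suc homogeneous_0 homogeneous_uminus)
  have rows2: "list_all2 (\<lambda>a row. list_all2 (\<lambda>b s. a < b \<and> homogeneous (b - a) s) [d3 + (n + 2)] row)
      [1 + (n + 1), d2 + (n + 1), d3 + (n + 1), d3 + (n + 1)] [[r0], [r1], [r2], [r3]]"
    using homr hom_r0 ds by simp
  have gh0: "graded_hom (replicate 4 (n + 1)) [0] D0"
    "\<forall>i<length [0::nat]. \<forall>j<length (replicate 4 (n + 1)). Poly_Mapping.lookup (D0 $$ (i, j)) 0 = 0"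
    by (rule minimal_graded_hom_rows[OF rows0], simp add: D0_def numeral_eq_Suc)+
  have gh1: "graded_hom [1 + (n + 1), d2 + (n + 1), d3 + (n + 1), d3 + (n + 1)] (replicate 4 (n + 1)) D1"
    "\<forall>i<length (replicate 4 (n + 1)). \<forall>j<length [1 + (n + 1), d2 + (n + 1), d3 + (n + 1), d3 + (n + 1)].
      Poly_Mapping.lookup (D1 $$ (i, j)) 0 = 0"
    by (rule minimal_graded_hom_rows[OF rows1], simp add: D1_def numeral_eq_Suc)+
  have gh2: "graded_hom [d3 + (n + 2)] [1 + (n + 1), d2 + (n + 1), d3 + (n + 1), d3 + (n + 1)] D2"
    "\<forall>i<length [1 + (n + 1), d2 + (n + 1), d3 + (n + 1), d3 + (n + 1)]. \<forall>j<length [d3 + (n + 2)].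
      Poly_Mapping.lookup (D2 $$ (i, j)) 0 = 0"
    by (rule minimal_graded_hom_rows[OF rows2], simp add: D2_def numeral_eq_Suc)+
  have surj: "(\<lambda>u. residue_class ?J (vec 1 (\<lambda>_. 1) \<bullet> u)) ` carrier_vec 1 = quotient_ring ?J"
  proof (intro equalityI subsetI)
    fix C assume "C \<in> quotient_ring ?J"
    then obtain s where "C = residue_class ?J (vec 1 (\<lambda>_. 1) \<bullet> vec 1 (\<lambda>_. s))"
      by (auto simp: quotient_ring_def scalar_prod_def)
    then show "C \<in> (\<lambda>u. residue_class ?J (vec 1 (\<lambda>_. 1) \<bullet> u)) ` carrier_vec 1"
      by (rule image_eqI) simp
  qed (auto simp: quotient_ring_def)
  have all3: "(\<forall>k<length [D0, D1, D2]. P k) \<longleftrightarrow> P 0 \<and> P 1 \<and> P 2" for P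
    using all_less_three[of P] by (simp add: numeral_3_eq_3)
  have nths: "?Fs ! 0 = [0]" "?Fs ! Suc 0 = replicate 4 (n + 1)"
    "?Fs ! 1 = replicate 4 (n + 1)" "?Fs ! Suc 1 = [1 + (n + 1), d2 + (n + 1), d3 + (n + 1), d3 + (n + 1)]"
    "?Fs ! 2 = [1 + (n + 1), d2 + (n + 1), d3 + (n + 1), d3 + (n + 1)]" "?Fs ! Suc 2 = [d3 + (n + 2)]"
    "[D0, D1, D2] ! 0 = D0" "[D0, D1, D2] ! 1 = D1" "[D0, D1, D2] ! 2 = D2" "length [0::nat] = 1"
    by simp_all
  have inc: "incoming_image ?Fs [D0, D1, D2] 0 = mat_image D0"
    "incoming_image ?Fs [D0, D1, D2] (Suc 0) = mat_image D1"
    "incoming_image ?Fs [D0, D1, D2] (Suc 1) = mat_image D2"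
    "incoming_image ?Fs [D0, D1, D2] (Suc 2) = {0\<^sub>v 1}"
    by (simp_all add: incoming_image_def)
  have "minimal_graded_free_resolution ?J ?Fs (vec 1 (\<lambda>_. 1)) [D0, D1, D2]"
    unfolding minimal_graded_free_resolution_def all3 nths inc
  proof (intro conjI)
    show "\<forall>j<1. homogeneous ([0] ! j) (vec 1 (\<lambda>_. 1) $ j)" by (simp add: homogeneous_1)
  qed (use gh0 gh1 gh2 im0 im1 im2 im3 surj in \<open>simp_all only: nths vec_carrier\<close>, simp_all)
  then show ?thesis
    unfolding nearly_free_def using f ds by auto
qed

lemma of_nat_dvd_one: "0 < k \<Longrightarrow> of_nat k dvd (1 :: S)"
  using Const_dvd_one[of "of_nat k"] by (simp add: Const_of_nat)

lemma numeral_dvd_one: "numeral k dvd (1 :: S)"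
  using Const_dvd_one[of "numeral k"] by (simp add: Const_numeral)

text \<open>
  The criterion for the surface of degree \<open>n + 2\<close>, with \<open>x\<^bsup>n\<^esup>\<close> and the two long partial derivatives \<open>p\<close> and \<open>q\<close>
  given in any convenient form. As \<open>(x, y)\<close> is prime, regularity of \<open>r\<^sub>2\<close> is just nonvanishing at \<open>x = y = 0\<close>.
\<close>
lemma surface_nearly_freeI:
  fixes x y z w p q xn a1 a2 a3 b1 b2 b3 c1 c2 c3 e1 e2 e3 r1 r2 r3 k l h :: S
  assumes n: "2 \<le> n" and vars: "x = Var 0" "y = Var 1" "z = Var 2" "w = Var 3" and xn: "xn = x ^ n"
    and p: "p = of_nat (n + 1) * x ^ n * z + of_nat n * x ^ (n - 1) * y * w + 4 * x ^ 3 * y ^ (n - 2)"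
    and q: "q = of_nat (n + 2) * y ^ (n + 1) + x ^ n * w + of_nat (n - 2) * x ^ 4 * y ^ (n - 3)"
    and syz: "a1 * p + b1 * q + c1 * (x * xn) + e1 * (xn * y) = 0"
      "a2 * p + b2 * q + c2 * (x * xn) + e2 * (xn * y) = 0"
      "a3 * p + b3 * q + c3 * (x * xn) + e3 * (xn * y) = 0"
    and minors: "a2 * b3 - a3 * b2 = xn * r1" "a3 * b1 - a1 * b3 = xn * r2" "a1 * b2 - a2 * b1 = xn * r3"
    and r1: "r1 * q = k * y ^ N + x * h" "k dvd 1"
    and r2: "subst_poly (Var(0 := 0, 1 := 0)) r2 \<noteq> 0"
    and r3: "r3 = l * x" "l dvd 1"
    and ds: "1 \<le> d2" "d2 \<le> d3"
    and hom1: "homogeneous d2 a1" "homogeneous d2 b1" "homogeneous d2 c1" "homogeneous d2 e1"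
    and hom2: "homogeneous d3 a2" "homogeneous d3 b2" "homogeneous d3 c2" "homogeneous d3 e2"
    and hom3: "homogeneous d3 a3" "homogeneous d3 b3" "homogeneous d3 c3" "homogeneous d3 e3"
    and homr: "homogeneous (Suc d3 - d2) r1" "homogeneous 1 r2" "homogeneous 1 r3"
  shows "nearly_free (n + 2) (surface_poly (n + 2)) 1 d2 d3"
proof (rule nearly_freeI)
  show "homogeneous (n + 2) (surface_poly (n + 2))" "squarefree (surface_poly (n + 2))"
    "\<not> is_cone (surface_poly (n + 2))"
    using n by (simp_all add: homogeneous_surface_poly squarefree_surface_poly not_cone_surface_poly)
  have d: "4 \<le> n + 2" using n by simp
  have shifts: "n + 2 - 1 = Suc n" "n + 2 - 2 = n" "n + 2 - 3 = n - 1" "n + 2 - 4 = n - 2" "n + 2 - 5 = n - 3"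
    using n by auto
  note partials = partial_deriv_surface_poly[OF d, unfolded shifts]
  show "partial_deriv 0 (surface_poly (n + 2)) = p"
    using partials(1) unfolding p vars by simp
  show "partial_deriv 1 (surface_poly (n + 2)) = q"
    using partials(2) unfolding q vars by simp
  show "partial_deriv 2 (surface_poly (n + 2)) = Var 0 * Var 0 ^ n"
    "partial_deriv 3 (surface_poly (n + 2)) = Var 0 ^ n * Var 1"
    using partials(3,4) by simp_all
  show "syzygy_block (Var 0) (Var 1) p q (Var 0 ^ n) n N a1 a2 a3 b1 b2 b3 c1 c2 c3 e1 e2 e3 r1 r2 r3 k l h"
  proof
    let ?s = "subst_poly (Var(0 := 0, 1 := 0))"
    have in_xy: "?s t = 0" if "t = Var 0 * \<alpha> + Var 1 * \<beta>" for t \<alpha> \<beta>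
      using that in_ideal_two_Vars_iff[of 0 1 t] by auto
    show "\<not> Var 0 dvd r2"
    proof
      assume "Var 0 dvd r2"
      then obtain \<alpha> where "r2 = Var 0 * \<alpha> + Var 1 * 0" by auto
      then show False using in_xy r2 by blast
    qed
    fix t \<alpha> \<beta> assume "r2 * t = Var 0 * \<alpha> + Var 1 * \<beta>"
    then have "?s t = 0" using in_xy r2 by (metis subst_poly_mult mult_eq_0_iff)
    then show "\<exists>\<alpha>' \<beta>'. t = Var 0 * \<alpha>' + Var 1 * \<beta>'"
      using in_ideal_two_Vars_iff[of 0 1 t] by simp
  qed (use syz minors r1 r3 in \<open>simp_all add: prime_elem_Var Var_dvd_Var_iff xn vars\<close>)
  note hom_vars = homogeneous_Var[of 0] homogeneous_Var[of 1] homogeneous_Var[of 2] homogeneous_Var[of 3]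
  show "homogeneous (Suc n) p"
    unfolding p vars using n by (auto intro!: homogeneous_add homogeneous_mult homogeneous_power
      homogeneous_of_nat homogeneous_numeral homogeneous_1 hom_vars)
  show "homogeneous (Suc n) q"
  (* For n = 2 the last term of q has the wrong degree, but its coefficient n - 2 vanishes. *)
  proof (cases "n = 2")
    case True
    then show ?thesis unfolding q vars
      by (auto intro!: homogeneous_add homogeneous_mult homogeneous_power homogeneous_0
        homogeneous_of_nat homogeneous_numeral homogeneous_1 hom_vars)
  next
    case False
    show ?thesis unfolding q vars
      by (rule homogeneous_add homogeneous_mult homogeneous_power homogeneous_of_nat hom_vars refl
        | (insert n False, simp; fail))+
  qed
qed (fact ds hom1 hom2 hom3 homr)+

section \<open>The generating syzygies\<close>

text \<open>
  A pair \<open>(a, b)\<close> extends to a syzygy iff \<open>ap + bq\<close> lies in \<open>x\<^bsup>d-2\<^esup>(x, y)\<close>. The generators below solve this condition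
  power by power in \<open>x\<close>. For \<open>d \<le> 6\<close> the polynomial \<open>p\<close> is divisible by \<open>x\<^bsup>d-3\<^esup>\<close>, which forces \<open>b\<close> to be so
  too; the solutions are then \<open>(x, 0)\<close>, \<open>(0, x\<^bsup>d-2\<^esup>)\<close> and the pair that kills the terms with the lowest power
  of \<open>x\<close>. In each case the minors of the pairs give, up to units, \<open>r = (y\<^bsup>j\<^esup>, w + \<lambda>y, x)\<close>.
\<close>
lemma nearly_free_surface_4: "nearly_free 4 (surface_poly 4) 1 1 2"
proof -
  obtain x y z w :: S where vars: "x = Var 0" "y = Var 1" "z = Var 2" "w = Var 3" by blast
  have hom: "homogeneous 1 x" "homogeneous 1 y" "homogeneous 1 z" "homogeneous 1 w"
    unfolding vars by (rule homogeneous_Var)+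
  note hom_intros = homogeneous_add homogeneous_diff homogeneous_uminus homogeneous_mult
    homogeneous_power hom homogeneous_numeral homogeneous_of_nat homogeneous_1 homogeneous_0
  have n: "(2::nat) \<le> 2" by simp
  have p: "3 * x ^ 2 * z + 2 * x * y * w + 4 * x ^ 3 =
      of_nat (2 + 1) * x ^ 2 * z + of_nat 2 * x ^ (2 - 1) * y * w + 4 * x ^ 3 * y ^ (2 - 2)"
    by simp
  have q: "4 * y ^ 3 + x ^ 2 * w =
      of_nat (2 + 2) * y ^ (2 + 1) + x ^ 2 * w + of_nat (2 - 2) * x ^ 4 * y ^ (2 - 3)"
    by simp
  have "nearly_free (2 + 2) (surface_poly (2 + 2)) 1 1 2"
  proof (rule surface_nearly_freeI[OF n vars refl p q, where
      ?a1.0 = "x" and ?b1.0 = "0" and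
      ?c1.0 = "- 3 * z - 4 * x" and ?e1.0 = "- 2 * w" and
      ?a2.0 = "0" and ?b2.0 = "x ^ 2" and
      ?c2.0 = "- x * w" and ?e2.0 = "- 4 * y ^ 2" and
      ?a3.0 = "- 2 * y ^ 2" and ?b3.0 = "x * w" and
      ?c3.0 = "8 * y ^ 2 - w ^ 2" and ?e3.0 = "6 * y * z" and
      ?r1.0 = "2 * y ^ 2" and ?r2.0 = "- w" and ?r3.0 = "x" and
      k = "8" and N = 5 and l = "1" and
      h = "2 * x * y ^ 2 * w"])
    show "8 dvd (1 :: S)" by (rule numeral_dvd_one)
    show "subst_poly (Var(0 := 0, 1 := 0)) (- w) \<noteq> 0"
      unfolding vars by (simp add: subst_poly_hom)
    show "1 dvd (1 :: S)" by (simp add: numeral_dvd_one)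
  qed (rule refl | rule hom_intros | linarith | (Groebner_Basis.algebra; fail) | (simp; fail))+
  then show ?thesis by simp
qed

lemma nearly_free_surface_5: "nearly_free 5 (surface_poly 5) 1 1 3"
proof -
  obtain x y z w :: S where vars: "x = Var 0" "y = Var 1" "z = Var 2" "w = Var 3" by blast
  have hom: "homogeneous 1 x" "homogeneous 1 y" "homogeneous 1 z" "homogeneous 1 w"
    unfolding vars by (rule homogeneous_Var)+
  note hom_intros = homogeneous_add homogeneous_diff homogeneous_uminus homogeneous_mult
    homogeneous_power hom homogeneous_numeral homogeneous_of_nat homogeneous_1 homogeneous_0
  have n: "(2::nat) \<le> 3" by simp
  have p: "4 * x ^ 3 * z + 3 * x ^ 2 * y * w + 4 * x ^ 3 * y =
      of_nat (3 + 1) * x ^ 3 * z + of_nat 3 * x ^ (3 - 1) * y * w + 4 * x ^ 3 * y ^ (3 - 2)"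
    by simp
  have q: "5 * y ^ 4 + x ^ 3 * w + x ^ 4 =
      of_nat (3 + 2) * y ^ (3 + 1) + x ^ 3 * w + of_nat (3 - 2) * x ^ 4 * y ^ (3 - 3)"
    by simp
  have "nearly_free (3 + 2) (surface_poly (3 + 2)) 1 1 3"
  proof (rule surface_nearly_freeI[OF n vars refl p q, where
      ?a1.0 = "x" and ?b1.0 = "0" and
      ?c1.0 = "- 4 * z - 4 * y" and ?e1.0 = "- 3 * w" and
      ?a2.0 = "0" and ?b2.0 = "x ^ 3" and
      ?c2.0 = "- (x ^ 2 * w) - x ^ 3" and ?e2.0 = "- 5 * y ^ 3" and
      ?a3.0 = "- 5 * y ^ 3" and ?b3.0 = "3 * x ^ 2 * w" and
      ?c3.0 = "- 3 * x * w ^ 2 - 3 * x ^ 2 * w" and ?e3.0 = "20 * y ^ 2 * z + 20 * y ^ 3" and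
      ?r1.0 = "5 * y ^ 3" and ?r2.0 = "- 3 * w" and ?r3.0 = "x" and
      k = "25" and N = 7 and l = "1" and
      h = "5 * y ^ 3 * (x ^ 2 * w + x ^ 3)"])
    show "25 dvd (1 :: S)" by (rule numeral_dvd_one)
    show "subst_poly (Var(0 := 0, 1 := 0)) (- 3 * w) \<noteq> 0"
      unfolding vars by (simp add: subst_poly_hom)
    show "1 dvd (1 :: S)" by (simp add: numeral_dvd_one)
  qed (rule refl | rule hom_intros | linarith | (Groebner_Basis.algebra; fail) | (simp; fail))+
  then show ?thesis by simp
qed

lemma nearly_free_surface_6: "nearly_free 6 (surface_poly 6) 1 1 4"
proof -
  obtain x y z w :: S where vars: "x = Var 0" "y = Var 1" "z = Var 2" "w = Var 3" by blast
  have hom: "homogeneous 1 x" "homogeneous 1 y" "homogeneous 1 z" "homogeneous 1 w"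
    unfolding vars by (rule homogeneous_Var)+
  note hom_intros = homogeneous_add homogeneous_diff homogeneous_uminus homogeneous_mult
    homogeneous_power hom homogeneous_numeral homogeneous_of_nat homogeneous_1 homogeneous_0
  have n: "(2::nat) \<le> 4" by simp
  have p: "5 * x ^ 4 * z + 4 * x ^ 3 * y * w + 4 * x ^ 3 * y ^ 2 =
      of_nat (4 + 1) * x ^ 4 * z + of_nat 4 * x ^ (4 - 1) * y * w + 4 * x ^ 3 * y ^ (4 - 2)"
    by simp
  have q: "6 * y ^ 5 + x ^ 4 * w + 2 * x ^ 4 * y =
      of_nat (4 + 2) * y ^ (4 + 1) + x ^ 4 * w + of_nat (4 - 2) * x ^ 4 * y ^ (4 - 3)"
    by simp
  have "nearly_free (4 + 2) (surface_poly (4 + 2)) 1 1 4"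
  proof (rule surface_nearly_freeI[OF n vars refl p q, where
      ?a1.0 = "x" and ?b1.0 = "0" and
      ?c1.0 = "- 5 * z" and ?e1.0 = "- 4 * w - 4 * y" and
      ?a2.0 = "0" and ?b2.0 = "x ^ 4" and
      ?c2.0 = "- (x ^ 3 * (w + 2 * y))" and ?e2.0 = "- 6 * y ^ 4" and
      ?a3.0 = "- 6 * y ^ 4" and ?b3.0 = "4 * x ^ 3 * (w + y)" and
      ?c3.0 = "- 4 * x ^ 2 * (w + y) * (w + 2 * y)" and ?e3.0 = "30 * y ^ 3 * z" and
      ?r1.0 = "6 * y ^ 4" and ?r2.0 = "- 4 * (w + y)" and ?r3.0 = "x" and
      k = "36" and N = 9 and l = "1" and
      h = "6 * y ^ 4 * (x ^ 3 * w + 2 * x ^ 3 * y)"])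
    show "36 dvd (1 :: S)" by (rule numeral_dvd_one)
    show "subst_poly (Var(0 := 0, 1 := 0)) (- 4 * (w + y)) \<noteq> 0"
      unfolding vars by (simp add: subst_poly_hom)
    show "1 dvd (1 :: S)" by (simp add: numeral_dvd_one)
  qed (rule refl | rule hom_intros | linarith | (Groebner_Basis.algebra; fail) | (simp; fail))+
  then show ?thesis by simp
qed

text \<open>
  From degree \<open>9\<close> on, the largest power of \<open>x\<close> dividing \<open>p\<close> is \<open>x\<^sup>3\<close>, so \<open>b = x\<^sup>3b'\<close>. The lowest terms of \<open>p\<close> and \<open>q\<close> require
  \<open>4a + dy\<^sup>3b'\<close> to be small \<open>x\<close>-adically, and the generators have \<open>b'\<close> equal to \<open>x\<close>, \<open>0\<close> and \<open>y\<close> for \<open>d = 9\<close>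
  and to \<open>x\<close>, \<open>0\<close> and \<open>y\<^sup>2\<close> for \<open>d = 10\<close>, up to constants. The terms of \<open>a\<close> containing \<open>w\<close> cancel the mixed
  term of \<open>p\<close>.
\<close>
lemma nearly_free_surface_9: "nearly_free 9 (surface_poly 9) 1 4 4"
proof -
  obtain x y z w :: S where vars: "x = Var 0" "y = Var 1" "z = Var 2" "w = Var 3" by blast
  have hom: "homogeneous 1 x" "homogeneous 1 y" "homogeneous 1 z" "homogeneous 1 w"
    unfolding vars by (rule homogeneous_Var)+
  note hom_intros = homogeneous_add homogeneous_diff homogeneous_uminus homogeneous_mult
    homogeneous_power hom homogeneous_numeral homogeneous_of_nat homogeneous_1 homogeneous_0
  have n: "(2::nat) \<le> 7" by simp
  have p: "8 * x ^ 7 * z + 7 * x ^ 6 * y * w + 4 * x ^ 3 * y ^ 5 =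
      of_nat (7 + 1) * x ^ 7 * z + of_nat 7 * x ^ (7 - 1) * y * w + 4 * x ^ 3 * y ^ (7 - 2)"
    by simp
  have q: "9 * y ^ 8 + x ^ 7 * w + 5 * x ^ 4 * y ^ 4 =
      of_nat (7 + 2) * y ^ (7 + 1) + x ^ 7 * w + of_nat (7 - 2) * x ^ 4 * y ^ (7 - 3)"
    by simp
  have "nearly_free (7 + 2) (surface_poly (7 + 2)) 1 4 4"
  proof (rule surface_nearly_freeI[OF n vars refl p q, where
      ?a1.0 = "- 9 * x * y ^ 3" and ?b1.0 = "4 * x ^ 4" and
      ?c1.0 = "72 * y ^ 3 * z - 4 * x ^ 3 * w - 20 * y ^ 4" and ?e1.0 = "63 * y ^ 3 * w" and
      ?a2.0 = "x ^ 4" and ?b2.0 = "0" and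
      ?c2.0 = "- 8 * x ^ 3 * z" and ?e2.0 = "- 7 * x ^ 3 * w - 4 * y ^ 4" and
      ?a3.0 = "63 * x ^ 3 * w - 36 * y ^ 4" and ?b3.0 = "16 * x ^ 3 * y" and
      ?c3.0 = "- 504 * x ^ 2 * z * w" and ?e3.0 = "288 * y ^ 3 * z - 441 * x ^ 2 * w ^ 2 - 16 * x ^ 3 * w - 80 * y ^ 4" and
      ?r1.0 = "16 * y" and ?r2.0 = "252 * w" and ?r3.0 = "- 4 * x" and
      k = "144" and N = 9 and l = "- 4" and
      h = "16 * y * (x ^ 6 * w + 5 * x ^ 3 * y ^ 4)"])
    show "144 dvd (1 :: S)" by (rule numeral_dvd_one)
    show "subst_poly (Var(0 := 0, 1 := 0)) (252 * w) \<noteq> 0"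
      unfolding vars by (simp add: subst_poly_hom)
    show "- 4 dvd (1 :: S)" by (simp add: numeral_dvd_one)
  qed (rule refl | rule hom_intros | linarith | (Groebner_Basis.algebra; fail) | (simp; fail))+
  then show ?thesis by simp
qed

lemma nearly_free_surface_10: "nearly_free 10 (surface_poly 10) 1 4 5"
proof -
  obtain x y z w :: S where vars: "x = Var 0" "y = Var 1" "z = Var 2" "w = Var 3" by blast
  have hom: "homogeneous 1 x" "homogeneous 1 y" "homogeneous 1 z" "homogeneous 1 w"
    unfolding vars by (rule homogeneous_Var)+
  note hom_intros = homogeneous_add homogeneous_diff homogeneous_uminus homogeneous_mult
    homogeneous_power hom homogeneous_numeral homogeneous_of_nat homogeneous_1 homogeneous_0
  have n: "(2::nat) \<le> 8" by simp
  have p: "9 * x ^ 8 * z + 8 * x ^ 7 * y * w + 4 * x ^ 3 * y ^ 6 =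
      of_nat (8 + 1) * x ^ 8 * z + of_nat 8 * x ^ (8 - 1) * y * w + 4 * x ^ 3 * y ^ (8 - 2)"
    by simp
  have q: "10 * y ^ 9 + x ^ 8 * w + 6 * x ^ 4 * y ^ 5 =
      of_nat (8 + 2) * y ^ (8 + 1) + x ^ 8 * w + of_nat (8 - 2) * x ^ 4 * y ^ (8 - 3)"
    by simp
  have "nearly_free (8 + 2) (surface_poly (8 + 2)) 1 4 5"
  proof (rule surface_nearly_freeI[OF n vars refl p q, where
      ?a1.0 = "- 5 * x * y ^ 3" and ?b1.0 = "2 * x ^ 4" and
      ?c1.0 = "45 * y ^ 3 * z - 2 * x ^ 3 * w" and ?e1.0 = "40 * y ^ 3 * w - 12 * y ^ 4" and
      ?a2.0 = "x ^ 5" and ?b2.0 = "0" and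
      ?c2.0 = "- 9 * x ^ 4 * z" and ?e2.0 = "- 8 * x ^ 4 * w - 4 * y ^ 5" and
      ?a3.0 = "x ^ 4 * (10 * w - 3 * y) - 5 * y ^ 5" and ?b3.0 = "2 * x ^ 3 * y ^ 2" and
      ?c3.0 = "- 9 * x ^ 3 * z * (10 * w - 3 * y)" and ?e3.0 = "45 * y ^ 4 * z - 8 * x ^ 3 * w * (10 * w - 3 * y) - 2 * x ^ 3 * y * w" and
      ?r1.0 = "2 * y ^ 2" and ?r2.0 = "20 * w - 6 * y" and ?r3.0 = "- 2 * x" and
      k = "20" and N = 11 and l = "- 2" and
      h = "2 * y ^ 2 * (x ^ 7 * w + 6 * x ^ 3 * y ^ 5)"])
    show "20 dvd (1 :: S)" by (rule numeral_dvd_one)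
    show "subst_poly (Var(0 := 0, 1 := 0)) (20 * w - 6 * y) \<noteq> 0"
      unfolding vars by (simp add: subst_poly_hom)
    show "- 2 dvd (1 :: S)" by (simp add: numeral_dvd_one)
  qed (rule refl | rule hom_intros | linarith | (Groebner_Basis.algebra; fail) | (simp; fail))+
  then show ?thesis by simp
qed

text \<open>
  Now the first generator cancels \<open>y\<^bsup>d-5\<^esup>(dy\<^sup>4 + (d-4)x\<^sup>4)\<close>, the part of \<open>q\<close> without \<open>w\<close>, against the term
  \<open>4x\<^sup>3y\<^bsup>d-4\<^esup>\<close> of \<open>p\<close>. With \<open>b = 4x\<^sup>3b'\<close> the generators have \<open>b'\<close> equal to \<open>xy\<close>, \<open>x\<^bsup>d-9\<^esup>\<close> and
  \<open>d(d-2)x\<^bsup>d-10\<^esup>w + 4(d-4)y\<^bsup>d-9\<^esup>\<close>. The ratio of the two constants in the last one is forced: it makes the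
  contributions \<open>x\<^bsup>d-3\<^esup>y\<^bsup>d-5\<^esup>w\<close> of \<open>p\<close> and \<open>q\<close> cancel. Writing \<open>d = m + 11\<close>, the powers \<open>X = x\<^bsup>m\<^esup>\<close>,
  \<open>Y = y\<^bsup>m\<^esup>\<close> and the coefficients \<open>D, E, F, G = d, d - 1, d - 2, d - 4\<close> enter the identities as indeterminates.
\<close>
lemma nearly_free_surface_general: "nearly_free (m + 11) (surface_poly (m + 11)) 1 5 (m + 5)"
proof -
  obtain x y z w :: S where vars: "x = Var 0" "y = Var 1" "z = Var 2" "w = Var 3" by blast
  have hom: "homogeneous 1 x" "homogeneous 1 y" "homogeneous 1 z" "homogeneous 1 w"
    unfolding vars by (rule homogeneous_Var)+
  note hom_intros = homogeneous_add homogeneous_diff homogeneous_uminus homogeneous_mult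
    homogeneous_power hom homogeneous_numeral homogeneous_of_nat homogeneous_1 homogeneous_0
  obtain X Y where XY: "X = x ^ m" "Y = y ^ m" by blast
  obtain D E F G :: S where coeffs: "D = of_nat (m + 11)" "E = of_nat (m + 10)" "F = of_nat (m + 9)"
    "G = of_nat (m + 7)" by blast
  have units: "D dvd 1" "F dvd 1" "G dvd 1" unfolding coeffs by (rule of_nat_dvd_one, simp)+
  have homXY: "homogeneous m X" "homogeneous m Y"
    unfolding XY by (rule hom_intros | simp)+
  have homc: "homogeneous 0 D" "homogeneous 0 E" "homogeneous 0 F" "homogeneous 0 G"
    unfolding coeffs by (rule homogeneous_of_nat)+
  note hom_intros = hom_intros homXY homc
  have n: "2 \<le> m + 9" by simp
  have xn: "x ^ 9 * X = x ^ (m + 9)" by (simp add: XY power_add)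
  have shifts: "m + 9 - 1 = m + 8" "m + 9 - 2 = m + 7" "m + 9 - 3 = m + 6" "m + 9 + 1 = m + 10" "m + 9 + 2 = m + 11"
    by simp_all
  have p: "E * (x ^ 9 * X) * z + F * (x ^ 8 * X) * y * w + 4 * x ^ 3 * (y ^ 7 * Y) =
      of_nat (m + 9 + 1) * x ^ (m + 9) * z + of_nat (m + 9) * x ^ (m + 9 - 1) * y * w
      + 4 * x ^ 3 * y ^ (m + 9 - 2)"
    unfolding shifts coeffs XY power_add by (simp only: mult.commute)
  have q: "D * (y ^ 10 * Y) + x ^ 9 * X * w + G * x ^ 4 * (y ^ 6 * Y) =
      of_nat (m + 9 + 2) * y ^ (m + 9 + 1) + x ^ (m + 9) * w
      + of_nat (m + 9 - 2) * x ^ 4 * y ^ (m + 9 - 3)"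
    unfolding shifts coeffs XY power_add by (simp only: mult.commute)
  have "nearly_free ((m + 9) + 2) (surface_poly ((m + 9) + 2)) 1 5 (m + 5)"
  proof (rule surface_nearly_freeI[OF n vars xn p q, where
      ?a1.0 = "- x * (D * y ^ 4 + G * x ^ 4)" and ?b1.0 = "4 * x ^ 4 * y" and
      ?c1.0 = "E * z * (D * y ^ 4 + G * x ^ 4)" and
      ?e1.0 = "F * w * (D * y ^ 4 + G * x ^ 4) - 4 * x ^ 4 * w" and
      ?a2.0 = "- D * (x ^ 2 * X) * y ^ 3" and ?b2.0 = "4 * (x ^ 5 * X)" and
      ?c2.0 = "D * E * (x * X) * y ^ 3 * z - 4 * (x ^ 4 * X) * w" and
      ?e2.0 = "D * F * (x * X) * y ^ 3 * w - 4 * G * (y ^ 5 * Y)" and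
      ?a3.0 = "- D * y ^ 3 * (D * F * (x * X) * w + 4 * G * (y ^ 2 * Y)) - 4 * G ^ 2 * x ^ 4 * (y * Y)" and
      ?b3.0 = "4 * x ^ 3 * (D * F * (x * X) * w + 4 * G * (y ^ 2 * Y))" and
      ?c3.0 = "4 * G ^ 2 * E * x ^ 3 * (y * Y) * z
        - 4 * x ^ 2 * (D * F * (x * X) * w + 4 * G * (y ^ 2 * Y)) * w" and
      ?e3.0 = "D * E * y ^ 2 * (D * F * (x * X) * w + 4 * G * (y ^ 2 * Y)) * z
        + D ^ 2 * F ^ 2 * X * y ^ 3 * w ^ 2 + 4 * G ^ 2 * F * x ^ 3 * (y * Y) * w" and
      ?r1.0 = "16 * G ^ 2 * (y * Y)" and ?r2.0 = "4 * D * F * G * w" and ?r3.0 = "- 4 * G * x" and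
      k = "16 * D * G ^ 2" and N = "2 * m + 11" and l = "- 4 * G" and
      h = "16 * G ^ 2 * (y * Y) * (x ^ 8 * X * w + G * x ^ 3 * (y ^ 6 * Y))"])
    have "y ^ (2 * m + 11) = Y * Y * y ^ 11"
      by (simp only: XY mult_2 power_add)
    moreover have "16 * G ^ 2 * (y * Y) * (D * (y ^ 10 * Y) + x ^ 9 * X * w + G * x ^ 4 * (y ^ 6 * Y)) =
        16 * D * G ^ 2 * (Y * Y * y ^ 11)
        + x * (16 * G ^ 2 * (y * Y) * (x ^ 8 * X * w + G * x ^ 3 * (y ^ 6 * Y)))"
      by Groebner_Basis.algebra
    ultimately show "16 * G ^ 2 * (y * Y) * (D * (y ^ 10 * Y) + x ^ 9 * X * w + G * x ^ 4 * (y ^ 6 * Y)) =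
        16 * D * G ^ 2 * y ^ (2 * m + 11)
        + x * (16 * G ^ 2 * (y * Y) * (x ^ 8 * X * w + G * x ^ 3 * (y ^ 6 * Y)))"
      by simp
    show "16 * D * G ^ 2 dvd 1" "- 4 * G dvd 1"
      using units by (simp_all add: power2_eq_square is_unit_mult_iff numeral_dvd_one)
    have subst_coeffs: "subst_poly \<sigma> D = D" "subst_poly \<sigma> F = F" "subst_poly \<sigma> G = G" for \<sigma>
      unfolding coeffs by (rule subst_poly_of_nat)+
    have "D \<noteq> 0" "F \<noteq> 0" "G \<noteq> 0" using units by auto
    then show "subst_poly (Var(0 := 0, 1 := 0)) (4 * D * F * G * w) \<noteq> 0"
      unfolding vars subst_poly_hom subst_coeffs by simp
  qed (rule refl | rule hom_intros | linarith | (Groebner_Basis.algebra; fail) | (simp; fail))+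
  then show ?thesis unfolding shifts .
qed

theorem proposition5p7:
  shows "nearly_free 4 (surface_poly 4) 1 1 2 \<and>
         nearly_free 5 (surface_poly 5) 1 1 3 \<and>
         nearly_free 6 (surface_poly 6) 1 1 4 \<and>
         nearly_free 9 (surface_poly 9) 1 4 4 \<and>
         nearly_free 10 (surface_poly 10) 1 4 5 \<and>
         (\<forall>d::nat. d \<ge> 11 \<longrightarrow> nearly_free d (surface_poly d) 1 5 (d - 6))"
proof (intro conjI allI impI)
  fix d :: nat
  assume "d \<ge> 11"
  then obtain m where d: "d = m + 11" by (metis add.commute le_Suc_ex)
  then have e: "d - 6 = m + 5" by simp
  show "nearly_free d (surface_poly d) 1 5 (d - 6)"
    unfolding e unfolding d by (rule nearly_free_surface_general)
qed (fact nearly_free_surface_4 nearly_free_surface_5 nearly_free_surface_6 nearly_free_surface_9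
    nearly_free_surface_10)+

end
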